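(* Let $(\mathbf{X}_t)_{t\in\mathbb{Z}}$ be a strictly stationary $\mathbb{R}^d$-valued sequence that is regularly varying with index $\alpha>0$. Let $C\subset\overline{\mathbb{R}}_0^d$ be a Borel set bounded away from zero which is a continuity set of $\mu$ (i.e. $\mu(\partial C)=0$), and suppose that for every $h\ge 1$ the set $C\times\overline{\mathbb{R}}^{d(h-1)}\times C\subset\overline{\mathbb{R}}_0^{(h+1)d}$ is a continuity set of $\nu_{h+1}$. Suppose that $(\mathbf{X}_t)$ is $\alpha$-mixing with rate function $(\alpha_h)$ and that there exist integer sequences $m_n,r_n\to\infty$ with $m_n/n\to0$ and $r_n/m_n\to0$ such that $$\lim_{n\to\infty}m_n\sum_{h=r_n}^{\infty}\alpha_h=0$$ and, for all $\epsilon>0$, $$\lim_{k\to\infty}\limsup_{n\to\infty}m_n\sum_{h=k}^{r_n}P(|\mathbf{X}_h|>\epsilon a_{m_n},\,|\mathbf{X}_0|>\epsilon a_{m_n})=0.$$ Let $$\widehat P_m(C)=\frac{m_n}{n}\sum_{t=1}^n I_{\{\mathbf{X}_t/a_{m_n}\in C\}},\qquad \tau_h(C)=\nu_{h+1}\big(C\times\overline{\mathbb{R}}^{d(h-1)}\times C\big),\quad h\ge1.$$ Then, as $n\to\infty$, $$E\widehat P_m(C)\to\mu(C),$$ $$\operatorname{var}(\widehat P_m(C))\sim\frac{m_n}{n}\Big[\mu(C)+2\sum_{h=1}^\infty\tau_h(C)\Big],$$ where, if $\mu(C)=0$, the last relation is interpreted as $\operatorname{var}(\widehat P_m(C))=o(m_n/n)$.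 In particular, $\widehat P_m(C)\to\mu(C)$ in probability.
   Context: Notation: $\overline{\mathbb{R}}=\mathbb{R}\cup\{\pm\infty\}$, $\overline{\mathbb{R}}_0^{k}=\overline{\mathbb{R}}^{k}\setminus\{\mathbf 0\}$; a set is bounded away from zero if it is contained in $\{\mathbf{x}:|\mathbf{x}|>\epsilon\}$ for some $\epsilon>0$. $I$ denotes an indicator. Regular variation: a strictly stationary $\mathbb{R}^d$-valued sequence $(\mathbf{X}_t)$ is regularly varying with index $\alpha>0$ if for every $h\ge1$ the lagged vector $\mathbf{Y}_h=\mathrm{vec}(\mathbf{X}_1,\dots,\mathbf{X}_h)$ satisfies, as $x\to\infty$, $$\frac{P(x^{-1}\mathbf{Y}_h\in\cdot)}{P(|\mathbf{Y}_h|>x)}\xrightarrow{v}\mu_h(\cdot)$$ (vague convergence on $\overline{\mathbb{R}}_0^{hd}$) for some non-null Radon measure $\mu_h$ on $\overline{\mathbb{R}}_0^{hd}$ with $\mu_h(tB)=t^{-\alpha}\mu_h(B)$ for all $t>0$ and Borel sets $B$. Let $(a_n)$ be a sequence with $a_n\uparrow\infty$ and $P(|\mathbf{X}_0|>a_n)\sim n^{-1}$. Then for every $h\ge1$, $nP(a_n^{-1}\mathbf{Y}_h\in\cdot)\xrightarrow{v}\nu_h(\cdot)=c_h\mu_h(\cdot)$ for some constant $c_h>0$; we write $\mu=\mu_1=\nu_1$. Mixing: $(\mathbf{X}_t)$ is $\alpha$-mixing with rate function $(\alpha_h)$ if $\alpha_h=\sup\{|P(A\cap B)-P(A)P(B)|:A\in\sigma(\mathbf{X}_s,s\le0),\,B\in\sigma(\mathbf{X}_s,s\ge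 h)\}\to0$ as $h\to\infty$. *)

theory Defs
  imports "HOL-Probability.Probability" "HOL-Library.Landau_Symbols"
begin

section \<open>Borel measures and vague convergence on a topological space\<close>

definition borel_of :: "'a topology \<Rightarrow> 'a measure" where
  "borel_of T = sigma (topspace T) {U. openin T U}"

text \<open>On the spaces used below, which are locally compact Hausdorff and second countable, a Borel
  measure that is finite on compact sets is automatically regular.\<close>

definition radon_measure :: "'a topology \<Rightarrow> 'a measure \<Rightarrow> bool" where
  "radon_measure T \<mu> \<longleftrightarrow>
     sets \<mu> = sets (borel_of T) \<and> (\<forall>K. compactin T K \<longrightarrow> emeasure \<mu> K < \<infinity>)"

definition vague_conv ::
  "'a topology \<Rightarrow> ('i \<Rightarrow> 'a measure) \<Rightarrow> 'a measure \<Rightarrow> 'i filter \<Rightarrow> bool" where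
  "vague_conv T N \<mu> F \<longleftrightarrow>
     (\<forall>f. continuous_map T euclideanreal f \<and>
          compactin T (T closure_of {x \<in> topspace T. f x \<noteq> 0}) \<longrightarrow>
          ((\<lambda>i. \<integral>x. f x \<partial>(N i)) \<longlongrightarrow> (\<integral>x. f x \<partial>\<mu>)) F)"

section \<open>Extended vectors and blocks of extended vectors\<close>

text \<open>A vector with entries in the extended reals is a function of type \<open>'d \<Rightarrow> ereal\<close>; its
  topology is the product topology.\<close>

type_synonym 'd evec = "'d \<Rightarrow> ereal"

definition ext_vec :: "real ^ 'd \<Rightarrow> ('d::finite) evec" where
  "ext_vec x = (\<lambda>j. ereal (x $ j))"

definition ext_norm :: "('d::finite) evec \<Rightarrow> ereal" where
  "ext_norm x =
     (if \<forall>j. \<bar>x j\<bar> \<noteq> \<infinity> then ereal (L2_set (\<lambda>j. real_of_ereal (x j)) UNIV) else \<infinity>)"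

definition bounded_away_from_zero :: "('d::finite) evec set \<Rightarrow> bool" where
  "bounded_away_from_zero C \<longleftrightarrow> (\<exists>\<epsilon>>0. C \<subseteq> {x. ext_norm x > ereal \<epsilon>})"

text \<open>Extended vectors of dimension \<open>h * d\<close> are families of \<open>h\<close> extended \<open>d\<close>-vectors, indexed by
  \<open>{1..h}\<close>.  The space of these vectors, with the origin removed:\<close>

definition punctured_space :: "nat \<Rightarrow> (nat \<Rightarrow> ('d::finite) evec) topology" where
  "punctured_space h =
     subtopology (product_topology (\<lambda>_. euclidean) {1..h}) (- {\<lambda>i\<in>{1..h}. \<lambda>j. 0})"

definition dilate :: "nat \<Rightarrow> real \<Rightarrow> (nat \<Rightarrow> 'd evec) \<Rightarrow> (nat \<Rightarrow> 'd evec)" where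
  "dilate h t y = (\<lambda>i\<in>{1..h}. \<lambda>j. ereal t * y i j)"

section \<open>Stationarity, mixing and regular variation\<close>

definition strictly_stationary ::
  "'a measure \<Rightarrow> (int \<Rightarrow> 'a \<Rightarrow> 'b::topological_space) \<Rightarrow> bool" where
  "strictly_stationary M X \<longleftrightarrow>
     (\<forall>J k. finite J \<longrightarrow>
        distr M (\<Pi>\<^sub>M t\<in>J. borel) (\<lambda>\<omega>. \<lambda>t\<in>J. X (t + k) \<omega>) =
        distr M (\<Pi>\<^sub>M t\<in>J. borel) (\<lambda>\<omega>. \<lambda>t\<in>J. X t \<omega>))"

definition generated_events ::
  "'a measure \<Rightarrow> (int \<Rightarrow> 'a \<Rightarrow> 'b::topological_space) \<Rightarrow> int set \<Rightarrow> 'a set set" where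
  "generated_events M X S =
     sigma_sets (space M) (\<Union>s\<in>S. {X s -` B \<inter> space M | B. B \<in> sets borel})"

definition mixing_coeff ::
  "'a measure \<Rightarrow> (int \<Rightarrow> 'a \<Rightarrow> 'b::topological_space) \<Rightarrow> nat \<Rightarrow> real" where
  "mixing_coeff M X h =
     (SUP (A, B) \<in> generated_events M X {..0} \<times> generated_events M X {int h..}.
        \<bar>measure M (A \<inter> B) - measure M A * measure M B\<bar>)"

definition alpha_mixing ::
  "'a measure \<Rightarrow> (int \<Rightarrow> 'a \<Rightarrow> 'b::topological_space) \<Rightarrow> bool" where
  "alpha_mixing M X \<longleftrightarrow> mixing_coeff M X \<longlonglongrightarrow> 0"

text \<open>The vector \<open>x\<^sup>-\<^sup>1 vec(X\<^sub>1, \<dots>, X\<^sub>h)\<close>, the norm of the unscaled vector, and the law of the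
  scaled vector as a measure on the punctured space (which drops any mass at the origin).\<close>

definition scaled_block ::
  "(int \<Rightarrow> 'a \<Rightarrow> real ^ 'd) \<Rightarrow> nat \<Rightarrow> real \<Rightarrow> 'a \<Rightarrow> nat \<Rightarrow> ('d::finite) evec" where
  "scaled_block X h x \<omega> = (\<lambda>i\<in>{1..h}. ext_vec (X (int i) \<omega> /\<^sub>R x))"

definition block_norm :: "(int \<Rightarrow> 'a \<Rightarrow> real ^ 'd) \<Rightarrow> nat \<Rightarrow> 'a \<Rightarrow> real" where
  "block_norm X h \<omega> = L2_set (\<lambda>i. norm (X (int i) \<omega>)) {1..h}"

definition scaled_law ::
  "'a measure \<Rightarrow> (int \<Rightarrow> 'a \<Rightarrow> real ^ 'd) \<Rightarrow> nat \<Rightarrow> real \<Rightarrow> (nat \<Rightarrow> ('d::finite) evec) measure" where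
  "scaled_law M X h x =
     distr (restrict_space M {\<omega> \<in> space M. scaled_block X h x \<omega> \<in> topspace (punctured_space h)})
       (borel_of (punctured_space h)) (scaled_block X h x)"

definition regularly_varying ::
  "'a measure \<Rightarrow> (int \<Rightarrow> 'a \<Rightarrow> real ^ ('d::finite)) \<Rightarrow> real \<Rightarrow> bool" where
  "regularly_varying M X \<alpha> \<longleftrightarrow> \<alpha> > 0 \<and>
     (\<forall>h\<ge>1. \<exists>\<mu>. radon_measure (punctured_space h) \<mu> \<and>
        emeasure \<mu> (space \<mu>) \<noteq> 0 \<and>
        (\<forall>t>0. \<forall>B\<in>sets \<mu>.
           emeasure \<mu> (dilate h t ` B) = ennreal (t powr (- \<alpha>)) * emeasure \<mu> B) \<and>
        vague_conv (punctured_space h)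
          (\<lambda>x. scale_measure (ennreal (1 / measure M {\<omega> \<in> space M. block_norm X h \<omega> > x}))
                 (scaled_law M X h x))
          \<mu> at_top)"

text \<open>The vague limit \<open>\<nu>\<^sub>h\<close> of \<open>n P(a\<^sub>n\<^sup>-\<^sup>1 vec(X\<^sub>1, \<dots>, X\<^sub>h) \<in> \<cdot>)\<close>.  A vague limit is unique, so for a
  regularly varying stationary sequence and \<open>P(|X\<^sub>0| > a\<^sub>n) \<sim> 1/n\<close> the choice operator picks out the
  only such measure.\<close>

definition tail_limit ::
  "'a measure \<Rightarrow> (int \<Rightarrow> 'a \<Rightarrow> real ^ 'd) \<Rightarrow> (nat \<Rightarrow> real) \<Rightarrow> nat \<Rightarrow> (nat \<Rightarrow> ('d::finite) evec) measure"
  where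
  "tail_limit M X a h =
     (SOME \<nu>. radon_measure (punctured_space h) \<nu> \<and>
        vague_conv (punctured_space h)
          (\<lambda>n. scale_measure (of_nat n) (scaled_law M X h (a n))) \<nu> sequentially)"

text \<open>\<open>\<mu> = \<nu>\<^sub>1\<close>, moved from one-element families to extended \<open>d\<close>-vectors.  It gives the origin
  measure zero.\<close>

definition tail_measure ::
  "'a measure \<Rightarrow> (int \<Rightarrow> 'a \<Rightarrow> real ^ 'd) \<Rightarrow> (nat \<Rightarrow> real) \<Rightarrow> ('d::finite) evec measure" where
  "tail_measure M X a = distr (tail_limit M X a 1) borel (\<lambda>y. y 1)"

section \<open>The estimator and the extremogram\<close>

text \<open>The set \<open>C \<times> E \<times> \<dots> \<times> E \<times> C\<close> with \<open>h + 1\<close> factors, \<open>E\<close> being the set of all extended vectors\<close>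

definition end_cylinder :: "nat \<Rightarrow> ('d::finite) evec set \<Rightarrow> (nat \<Rightarrow> 'd evec) set" where
  "end_cylinder h C = {y \<in> {1..h + 1} \<rightarrow>\<^sub>E UNIV. y 1 \<in> C \<and> y (h + 1) \<in> C}"

definition tau ::
  "'a measure \<Rightarrow> (int \<Rightarrow> 'a \<Rightarrow> real ^ 'd) \<Rightarrow> (nat \<Rightarrow> real) \<Rightarrow> ('d::finite) evec set \<Rightarrow> nat \<Rightarrow> real" where
  "tau M X a C h = measure (tail_limit M X a (h + 1)) (end_cylinder h C)"

definition P_hat ::
  "(int \<Rightarrow> 'a \<Rightarrow> real ^ 'd) \<Rightarrow> (nat \<Rightarrow> real) \<Rightarrow> (nat \<Rightarrow> nat) \<Rightarrow> ('d::finite) evec set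
     \<Rightarrow> nat \<Rightarrow> 'a \<Rightarrow> real" where
  "P_hat X a m C n \<omega> =
     real (m n) / real n * (\<Sum>t = 1..n. indicator C (ext_vec (X (int t) \<omega> /\<^sub>R a (m n))))"

end

theory Submission
  imports Defs
begin

text \<open>The estimator is \<open>m / n\<close> times a sum of indicators of the events \<open>E\<^sub>t = {X\<^sub>t / a\<^sub>m \<in> C}\<close>, so by
  stationarity its mean is \<open>m P(E\<^sub>0)\<close> and, for the lag probabilities \<open>p\<^sub>h = P(E\<^sub>0 \<inter> E\<^sub>h)\<close> and
  \<open>p = P(E\<^sub>0)\<close>,
  \<open>(n / m) var = m (p - p\<^sup>2) + 2 \<Sum>\<^sub>h (1 - h / n) (m p\<^sub>h - m p\<^sup>2)\<close>  (lemma \<open>exceedance_moments\<close>).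
  Everything then rests on two limits and one interchange of limits.

  The limits \<open>m p \<longlonglongrightarrow> \<mu>(C)\<close> and \<open>m p\<^sub>h \<longlonglongrightarrow> \<tau>\<^sub>h(C)\<close> are vague convergence applied to continuity
  sets away from the origin (lemmas \<open>tail_measure_tendsto\<close> and \<open>tau_tendsto\<close>).  They need a portmanteau
  theorem for vague convergence (\<open>portmanteau_vague\<close>), and they need that the measures \<open>tail_limit\<close>, which
  are introduced by choice, really are vague limits.  Regular variation normalises by the tail of the norm of
  a whole block, whereas \<open>a\<close> is adapted to a single \<open>|X\<^sub>0|\<close>, so the point is that the ratio of the two
  tails converges to a positive number (\<open>norm_tail_ratio\<close>).  The limit exists because homogeneity forbids
  mass on the sphere \<open>|y\<^sub>i| = 1\<close>; it is positive because otherwise stationarity and homogeneity would make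
  every set \<open>|y\<^sub>i| > s\<close> null, and these sets cover the punctured space.

  The sum over lags is cut in three (\<open>lag_sum_tendsto\<close>).  Finitely many lags \<open>h < k\<close> converge termwise,
  with \<open>m p\<^sup>2 \<longlonglongrightarrow> 0\<close>.  The lags between \<open>k\<close> and \<open>r\<close> are controlled by the anti-clustering condition
  for \<open>m p\<^sub>h\<close> and by \<open>r m p\<^sup>2 = (m p)\<^sup>2 r / m \<longlonglongrightarrow> 0\<close>.  For lags beyond \<open>r\<close> the difference \<open>p\<^sub>h - p\<^sup>2\<close>
  is bounded by the mixing coefficient.  The same anti-clustering bound makes \<open>\<Sum>\<^sub>h \<tau>\<^sub>h\<close> summable.  If
  \<open>\<mu>(C) = 0\<close> then all \<open>\<tau>\<^sub>h \<le> \<mu>(C)\<close> vanish, which turns the limit into the little-o statement.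
  Consistency is Chebyshev's inequality.\<close>

section \<open>Borel sets and a portmanteau theorem for vague convergence\<close>

lemma space_borel_of: "space (borel_of T) = topspace T"
  by (simp add: borel_of_def space_measure_of_conv)

lemma sets_borel_of: "sets (borel_of T) = sigma_sets (topspace T) {U. openin T U}"
  unfolding borel_of_def by (rule sets_measure_of) (auto dest: openin_subset)

lemma openin_sets_borel_of: "openin T U \<Longrightarrow> U \<in> sets (borel_of T)"
  by (simp add: sets_borel_of sigma_sets.Basic)

lemma closedin_sets_borel_of: "closedin T K \<Longrightarrow> K \<in> sets (borel_of T)"
proof -
  assume K: "closedin T K"
  then have "topspace (T) - K \<in> sets (borel_of T)"
    by (intro openin_sets_borel_of) (simp add: closedin_def)
  then have "space (borel_of T) - (topspace T - K) \<in> sets (borel_of T)"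
    by (rule sets.compl_sets)
  moreover have "space (borel_of T) - (topspace T - K) = K"
    using K by (auto simp: space_borel_of closedin_def)
  ultimately show ?thesis by simp
qed

lemma borel_measurable_continuous_map:
  assumes f: "continuous_map T euclidean f" and S: "sets N = sets (borel_of T)"
  shows "f \<in> borel_measurable N"
proof (rule borel_measurableI)
  fix U :: "'b set" assume "open U"
  then have "openin T {x \<in> topspace T. f x \<in> U}"
    using f by (simp add: openin_continuous_map_preimage)
  moreover have "f -` U \<inter> space N = {x \<in> topspace T. f x \<in> U}"
    using sets_eq_imp_space_eq[OF S] by (auto simp: space_borel_of)
  ultimately show "f -` U \<inter> space N \<in> sets N"
    using S openin_sets_borel_of by auto
qed

text \<open>A continuous injection \<open>\<Phi>\<close> into a metric space stands in for a metric on \<open>T\<close>: the images of compact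
  sets are closed, and a point outside \<open>K\<close> has positive distance from \<open>K\<close> in the image.\<close>

lemma compact_approx_continuous:
  fixes \<Phi> :: "'a \<Rightarrow> 'b::metric_space"
  assumes \<Phi>: "continuous_map T euclidean \<Phi>" "inj_on \<Phi> (topspace T)" and K: "compactin T K"
  obtains f :: "nat \<Rightarrow> 'a \<Rightarrow> real" where "\<And>k. continuous_map T euclideanreal (f k)"
    "\<And>k x. 0 \<le> f k x" "\<And>k x. f k x \<le> 1" "\<And>k x. x \<in> K \<Longrightarrow> f k x = 1"
    "\<And>x. x \<in> topspace T - K \<Longrightarrow> (\<lambda>k. f k x) \<longlonglongrightarrow> 0"
proof (cases "K = {}")
  case True
  show ?thesis by (rule that[of "\<lambda>_ _. 0"]) (use True in auto)
next
  case False
  define f where "f k x = max 0 (1 - real k * infdist (\<Phi> x) (\<Phi> ` K))" for k x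
  have cl: "closed (\<Phi> ` K)"
    using image_compactin[OF K \<Phi>(1)] by (simp add: compact_imp_closed)
  show ?thesis
  proof (rule that[of f])
    fix k
    have "continuous_map euclidean euclideanreal (\<lambda>z. max 0 (1 - real k * infdist z (\<Phi> ` K)))"
      by (auto intro!: continuous_intros)
    from continuous_map_compose[OF \<Phi>(1) this]
    show "continuous_map T euclideanreal (f k)" by (simp add: f_def[abs_def] comp_def)
  next
    fix x assume x: "x \<in> topspace T - K"
    then have "\<Phi> x \<notin> \<Phi> ` K"
      using \<Phi>(2) compactin_subset_topspace[OF K] by (auto simp: inj_on_def)
    then have d: "infdist (\<Phi> x) (\<Phi> ` K) > 0"
      using cl False by (simp add: infdist_pos_not_in_closed)
    obtain k0 where k0: "real k0 * infdist (\<Phi> x) (\<Phi> ` K) > 1"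
      using reals_Archimedean3[OF d] by blast
    have "f k x = 0" if "k \<ge> k0" for k
    proof -
      have "real k0 * infdist (\<Phi> x) (\<Phi> ` K) \<le> real k * infdist (\<Phi> x) (\<Phi> ` K)"
        using that by (intro mult_right_mono) (auto simp: infdist_nonneg)
      then show ?thesis using k0 by (simp add: f_def)
    qed
    then show "(\<lambda>k. f k x) \<longlonglongrightarrow> 0"
      by (intro tendsto_eventually) (auto simp: eventually_sequentially)
  qed (auto simp: f_def infdist_nonneg)
qed

text \<open>The function \<open>b\<close> is a cut-off, equal to 1 on \<open>A\<close>, that makes every test function compactly supported.
  The closure of \<open>A\<close> and the part of the support of \<open>b\<close> outside the interior of \<open>A\<close> are compact; continuous
  approximations of these two sets give test functions above and below the indicator of \<open>A\<close> whose
  \<open>\<nu>\<close>-integrals meet at \<open>\<nu>(A)\<close> because the frontier is null.\<close>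

lemma portmanteau_vague:
  fixes \<Phi> :: "'a \<Rightarrow> 'b::metric_space" and b :: "'a \<Rightarrow> real"
  assumes \<Phi>: "continuous_map T euclidean \<Phi>" "inj_on \<Phi> (topspace T)"
    and rad: "radon_measure T \<nu>" and conv: "vague_conv T N \<nu> F"
    and N: "\<And>i. finite_measure (N i)" "\<And>i. sets (N i) = sets (borel_of T)"
    and b: "continuous_map T euclideanreal b" "\<And>x. 0 \<le> b x" "\<And>x. b x \<le> 1"
      "compactin T (T closure_of {x \<in> topspace T. b x \<noteq> 0})"
    and A: "A \<in> sets (borel_of T)" "\<And>x. x \<in> A \<Longrightarrow> b x = 1"
      "emeasure \<nu> (T frontier_of A) = 0"
  shows "((\<lambda>i. measure (N i) A) \<longlongrightarrow> measure \<nu> A) F" and "emeasure \<nu> A < \<infinity>"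
proof -
  define S where "S = T closure_of {x \<in> topspace T. b x \<noteq> 0}"
  have S: "compactin T S" "closedin T S" using b by (auto simp: S_def)
  have b0: "b x = 0" if "x \<in> topspace T - S" for x
    using that closure_of_subset[of "{x \<in> topspace T. b x \<noteq> 0}" T] by (auto simp: S_def)
  have sets\<nu>: "sets \<nu> = sets (borel_of T)" and fin: "emeasure \<nu> S < \<infinity>"
    using rad S by (auto simp: radon_measure_def)
  have sp: "space \<nu> = topspace T" using sets_eq_imp_space_eq[OF sets\<nu>] by (simp add: space_borel_of)
  have spN: "space (N i) = topspace T" for i
    using sets_eq_imp_space_eq[OF N(2)] by (simp add: space_borel_of)
  have AT: "A \<subseteq> topspace T" using sets.sets_into_space[OF A(1)] by (simp add: space_borel_of)
  have AS: "A \<subseteq> S" using AT A(2) b0 by fastforce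
  have A\<nu>: "A \<in> sets \<nu>" and S\<nu>: "S \<in> sets \<nu>"
    using A(1) sets\<nu> closedin_sets_borel_of[OF S(2)] by auto
  show fA: "emeasure \<nu> A < \<infinity>"
    using emeasure_mono[OF AS S\<nu>] fin by (rule le_less_trans)
  define K where "K = T closure_of A"
  define O' where "O' = T interior_of A"
  define D where "D = S - O'"
  have KS: "K \<subseteq> S" unfolding K_def using AS S(2) by (simp add: closure_of_minimal)
  have K: "compactin T K" "closedin T K"
    using closed_compactin[OF S(1) KS] by (auto simp: K_def)
  have O'A: "O' \<subseteq> A" "A \<subseteq> K" "K - O' = T frontier_of A" "openin T O'"
    using AT by (auto simp: O'_def K_def frontier_of_def interior_of_subset closure_of_subset)
  have "closedin T D" unfolding D_def using S(2) O'A(4) by (intro closedin_diff) auto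
  then have D: "compactin T D" "closedin T D"
    using closed_compactin[OF S(1), of D] by (auto simp: D_def)
  have b1: "b x = 1" if "x \<in> A" for x using A(2) that .
  obtain f where f: "\<And>k. continuous_map T euclideanreal (f k)"
    "\<And>k x. 0 \<le> f k x" "\<And>k x. f k x \<le> 1" "\<And>k x. x \<in> K \<Longrightarrow> f k x = (1::real)"
    "\<And>x. x \<in> topspace T - K \<Longrightarrow> (\<lambda>k. f k x) \<longlonglongrightarrow> 0"
    using compact_approx_continuous[OF \<Phi> K(1)] by metis
  obtain g where g: "\<And>k. continuous_map T euclideanreal (g k)"
    "\<And>k x. 0 \<le> g k x" "\<And>k x. g k x \<le> 1" "\<And>k x. x \<in> D \<Longrightarrow> g k x = (1::real)"
    "\<And>x. x \<in> topspace T - D \<Longrightarrow> (\<lambda>k. g k x) \<longlonglongrightarrow> 0"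
    using compact_approx_continuous[OF \<Phi> D(1)] by metis
  \<comment> \<open>Multiplication by the cut-off turns any continuous function into a test function.\<close>
  have test: "((\<lambda>i. \<integral>x. b x * u x \<partial>(N i)) \<longlongrightarrow> (\<integral>x. b x * u x \<partial>\<nu>)) F"
    if "continuous_map T euclideanreal u" for u
  proof -
    have "continuous_map T euclideanreal (\<lambda>x. b x * u x)"
      using b(1) that by (rule continuous_map_real_mult)
    moreover have "compactin T (T closure_of {x \<in> topspace T. b x * u x \<noteq> 0})"
    proof (rule closed_compactin[OF S(1)])
      show "T closure_of {x \<in> topspace T. b x * u x \<noteq> 0} \<subseteq> S"
        unfolding S_def by (rule closure_of_mono) auto
    qed simp
    ultimately show ?thesis using conv unfolding vague_conv_def by blast
  qed
  have meas: "(\<lambda>x. b x * u x) \<in> borel_measurable \<nu>" "(\<lambda>x. b x * u x) \<in> borel_measurable (N i)"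
    if "continuous_map T euclideanreal u" for u i
    using borel_measurable_continuous_map[OF continuous_map_real_mult[OF b(1) that]] sets\<nu> N(2) by auto
  have bnd: "\<bar>b x * u x\<bar> \<le> 1" if "0 \<le> u x" "u x \<le> 1" for u :: "'a \<Rightarrow> real" and x
    using b(2)[of x] b(3)[of x] that by (simp add: abs_mult mult_le_one)
  have b_int: "integrable (N i) (\<lambda>x. b x * u x)"
    if "continuous_map T euclideanreal u" "\<And>x. 0 \<le> u x" "\<And>x. u x \<le> 1" for u i
  proof (rule finite_measure.integrable_const_bound[OF N(1)])
    show "AE x in N i. norm (b x * u x) \<le> 1"
      by (intro AE_I2) (simp only: real_norm_def, rule bnd[OF that(2,3)])
  qed (use meas(2)[OF that(1)] in auto)
  have S_int: "integrable \<nu> (indicator S :: _ \<Rightarrow> real)"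
    using S\<nu> fin by (simp add: integrable_indicator_iff)
  have lim: "(\<lambda>k. \<integral>x. b x * u k x \<partial>\<nu>) \<longlonglongrightarrow> measure \<nu> A"
    if u: "\<And>k. continuous_map T euclideanreal (u k)" "\<And>k x. 0 \<le> u k x" "\<And>k x. u k x \<le> 1"
      and pt: "\<And>x. x \<in> topspace T - T frontier_of A \<Longrightarrow> (\<lambda>k. b x * u k x) \<longlonglongrightarrow> indicator A x"
    for u :: "nat \<Rightarrow> 'a \<Rightarrow> real"
  proof -
    have "(\<lambda>k. \<integral>x. b x * u k x \<partial>\<nu>) \<longlonglongrightarrow> (\<integral>x. indicator A x \<partial>\<nu>)"
    proof (rule integral_dominated_convergence[where w="indicator S"])
      have "T frontier_of A \<in> null_sets \<nu>"
        using A(3) sets\<nu> closedin_sets_borel_of[OF closedin_frontier_of[of T A]] by auto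
      then have "AE x in \<nu>. x \<notin> T frontier_of A" by (rule AE_not_in)
      then show "AE x in \<nu>. (\<lambda>k. b x * u k x) \<longlonglongrightarrow> indicator A x"
        by (rule AE_mp) (auto simp: sp intro!: AE_I2 pt)
      show "AE x in \<nu>. norm (b x * u k x) \<le> indicator S x" for k
        using bnd[OF u(2,3)] b0 by (intro AE_I2) (auto simp: sp indicator_def)
    qed (use meas[OF u(1)] A\<nu> S_int in auto)
    then show ?thesis using A\<nu> by simp
  qed
  \<comment> \<open>The upper functions approach the indicator of the closure of \<open>A\<close>, the lower ones that of the interior.\<close>
  have limf: "(\<lambda>k. \<integral>x. b x * f k x \<partial>\<nu>) \<longlonglongrightarrow> measure \<nu> A"
  proof (rule lim[OF f(1-3)])
    fix x assume x: "x \<in> topspace T - T frontier_of A"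
    show "(\<lambda>k. b x * f k x) \<longlonglongrightarrow> indicator A x"
    proof (cases "x \<in> K")
      case True
      then have "x \<in> A" using x O'A by blast
      then show ?thesis using True f(4) b1 by simp
    next
      case False
      then have "x \<notin> A" using O'A by blast
      then show ?thesis using False x f(5)[of x] by (auto intro!: tendsto_mult_right_zero)
    qed
  qed
  have limg: "(\<lambda>k. \<integral>x. b x * (1 - g k x) \<partial>\<nu>) \<longlonglongrightarrow> measure \<nu> A"
  proof (rule lim)
    show "continuous_map T euclideanreal (\<lambda>x. 1 - g k x)" for k
      using g(1) by (intro continuous_intros)
    fix x assume x: "x \<in> topspace T - T frontier_of A"
    show "(\<lambda>k. b x * (1 - g k x)) \<longlonglongrightarrow> indicator A x"
    proof (cases "x \<in> O'")
      case True
      then have "x \<notin> D" "x \<in> A" using O'A by (auto simp: D_def)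
      then have "(\<lambda>k. b x * (1 - g k x)) \<longlonglongrightarrow> b x * (1 - 0)"
        using x by (intro tendsto_intros g(5)) auto
      then show ?thesis using b1 \<open>x \<in> A\<close> by simp
    next
      case False
      then have nA: "x \<notin> A" using x O'A by blast
      have "b x * (1 - g k x) = 0" for k
        using b0[of x] g(4)[of x k] x False by (cases "x \<in> S") (auto simp: D_def)
      then have "(\<lambda>k. b x * (1 - g k x)) = (\<lambda>k. 0)" by (rule ext)
      then show ?thesis using nA by simp
    qed
  qed (use g(2,3) in auto)
  have AN: "A \<in> sets (N i)" for i using A(1) N(2) by simp
  have intA: "integrable (N i) (indicator A :: _ \<Rightarrow> real)" for i
    using finite_measure.emeasure_finite[OF N(1), of i A] AN by (simp add: integrable_indicator_iff less_top)
  have up: "measure (N i) A \<le> (\<integral>x. b x * f k x \<partial>(N i))" for i k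
  proof -
    have "(\<integral>x. indicator A x \<partial>(N i)) \<le> (\<integral>x. b x * f k x \<partial>(N i))"
      using O'A(2) f(2,4) b(2) b1 
      by (intro integral_mono intA b_int f) (auto simp: indicator_def)
    then show ?thesis using AN by simp
  qed
  have lo: "(\<integral>x. b x * (1 - g k x) \<partial>(N i)) \<le> measure (N i) A" for i k
  proof -
    have "(\<integral>x. b x * (1 - g k x) \<partial>(N i)) \<le> (\<integral>x. indicator A x \<partial>(N i))"
    proof (intro integral_mono intA b_int)
      show "continuous_map T euclideanreal (\<lambda>x. 1 - g k x)"
        using g(1) by (intro continuous_intros)
      fix x assume x: "x \<in> space (N i)"
      show "b x * (1 - g k x) \<le> indicator A x"
      proof (cases "x \<in> A")
        case True then show ?thesis using b1 g(2) by simp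
      next
        case False
        then have "b x * (1 - g k x) = 0"
          using b0[of x] g(4)[of x k] x spN O'A(1) by (cases "x \<in> S") (auto simp: D_def)
        then show ?thesis by (simp only: indicator_pos_le)
      qed
    qed (use g in auto)
    then show ?thesis using AN by simp
  qed
  show "((\<lambda>i. measure (N i) A) \<longlongrightarrow> measure \<nu> A) F"
  proof (rule order_tendstoI)
    fix c assume "c < measure \<nu> A"
    then obtain k where "c < (\<integral>x. b x * (1 - g k x) \<partial>\<nu>)"
      using order_tendstoD(1)[OF limg] by (auto simp: eventually_sequentially)
    moreover have "((\<lambda>i. \<integral>x. b x * (1 - g k x) \<partial>(N i)) \<longlongrightarrow> (\<integral>x. b x * (1 - g k x) \<partial>\<nu>)) F"
      by (rule test) (intro continuous_intros g(1))
    ultimately have "\<forall>\<^sub>F i in F. c < (\<integral>x. b x * (1 - g k x) \<partial>(N i))"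
      by (rule order_tendstoD(1)[rotated])
    then show "\<forall>\<^sub>F i in F. c < measure (N i) A"
      by eventually_elim (use lo in \<open>blast intro: less_le_trans\<close>)
  next
    fix c assume "c > measure \<nu> A"
    then obtain k where "c > (\<integral>x. b x * f k x \<partial>\<nu>)"
      using order_tendstoD(2)[OF limf] by (auto simp: eventually_sequentially)
    from order_tendstoD(2)[OF test[OF f(1)] this]
    show "\<forall>\<^sub>F i in F. c > measure (N i) A"
      by eventually_elim (use up in \<open>blast intro: le_less_trans\<close>)
  qed
qed

section \<open>Blocks of extended vectors away from the origin\<close>

text \<open>Truncation to \<open>[-K, K]\<close>.  It is continuous on the whole extended line, which the conversion to a real number
  is not, and truncations at all levels together separate points.\<close>

definition clip :: "real \<Rightarrow> ereal \<Rightarrow> real" where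
  "clip K x = real_of_ereal (max (- ereal K) (min (ereal K) x))"

lemma continuous_clip: "continuous_on UNIV (clip K)"
proof -
  have fin: "max (- ereal K) (min (ereal K) x) \<noteq> \<infinity>" "max (- ereal K) (min (ereal K) x) \<noteq> - \<infinity>" for x
    by (auto simp: max_def min_def)
  have "continuous_on UNIV (\<lambda>x. max (- ereal K) (min (ereal K) x))"
    by (intro continuous_intros)
  then have "continuous_on UNIV (real_of_ereal \<circ> (\<lambda>x. max (- ereal K) (min (ereal K) x)))"
    by (rule continuous_on_compose) (rule continuous_on_subset[OF continuous_on_real], use fin in auto)
  then show ?thesis by (simp add: clip_def[abs_def] comp_def)
qed

lemma ereal_clip: "\<bar>x\<bar> \<le> ereal K \<Longrightarrow> ereal (clip K x) = x"
  by (cases x) (auto simp: clip_def max_def min_def abs_le_iff)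

lemma abs_clip_eq: "\<bar>x\<bar> > ereal K \<Longrightarrow> K \<ge> 0 \<Longrightarrow> \<bar>clip K x\<bar> = K"
  by (cases x) (auto simp: clip_def max_def min_def)

lemma clip_separates:
  assumes "x \<noteq> y"
  shows "\<exists>k. clip (real k) x \<noteq> clip (real k) y"
proof -
  have "\<exists>k. clip (real k) x < clip (real k) y" if "x < y" for x y
  proof -
    obtain r where r: "x < ereal r" "ereal r < y" using ereal_dense2[OF \<open>x < y\<close>] by auto
    obtain k where k: "real k > \<bar>r\<bar>" using reals_Archimedean2 by blast
    have "clip (real k) x < r" using r(1) k by (cases x) (auto simp: clip_def max_def min_def)
    moreover have "clip (real k) y \<ge> r" using r(2) k by (cases y) (auto simp: clip_def max_def min_def)
    ultimately show ?thesis by (meson less_le_trans)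
  qed
  from this[of x y] this[of y x] assms show ?thesis
    by (metis neq_iff)
qed

text \<open>The Euclidean norm after truncation: a continuous real function that compares with nonnegative thresholds below \<open>K\<close>
  exactly as \<open>ext_norm\<close> does.  It replaces a direct study of the topology of \<open>ext_norm\<close> at infinity.\<close>

definition clip_norm :: "real \<Rightarrow> ('d::finite) evec \<Rightarrow> real" where
  "clip_norm K x = L2_set (\<lambda>j. clip K (x j)) UNIV"

lemma abs_le_L2_set:
  fixes f :: "'d::finite \<Rightarrow> real"
  shows "\<bar>f j\<bar> \<le> L2_set f UNIV"
proof -
  have "\<bar>f j\<bar> \<le> L2_set (\<lambda>j. \<bar>f j\<bar>) UNIV" by (rule member_le_L2_set) auto
  then show ?thesis by (simp add: L2_set_def)
qed

lemma abs_le_ext_norm: "\<bar>x j\<bar> \<le> ext_norm x"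
proof (cases "\<forall>j. \<bar>x j\<bar> \<noteq> \<infinity>")
  case True
  have "\<bar>real_of_ereal (x j)\<bar> \<le> L2_set (\<lambda>j. real_of_ereal (x j)) UNIV"
    by (rule abs_le_L2_set)
  then have "ereal \<bar>real_of_ereal (x j)\<bar> \<le> ext_norm x" using True by (simp add: ext_norm_def)
  moreover obtain r where "x j = ereal r" using True[rule_format, of j] by (cases "x j") auto
  ultimately show ?thesis by simp
next
  case False
  then have "ext_norm x = \<infinity>" unfolding ext_norm_def by (rule if_not_P)
  then show ?thesis by simp
qed

text \<open>A norm dominates every entry, so an entry beyond \<open>K\<close> pushes \<open>ext_norm\<close> above \<open>K\<close>, and its truncation keeps
  \<open>clip_norm\<close> at \<open>K\<close> or more; without such an entry truncation changes nothing.\<close>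

lemma clip_norm_cases:
  assumes "K \<ge> 0"
  obtains "ext_norm x = ereal (clip_norm K x)" | "ereal K < ext_norm x" "K \<le> clip_norm K x"
proof (cases "\<forall>j. \<bar>x j\<bar> \<le> ereal K")
  case True
  then have "real_of_ereal (x j) = clip K (x j)" for j
    by (metis ereal_clip real_of_ereal.simps(1))
  moreover have "\<forall>j. \<bar>x j\<bar> \<noteq> \<infinity>" using True by (metis ereal_infty_less_eq(1) PInfty_neq_ereal(1))
  ultimately show ?thesis by (intro that(1)) (simp add: ext_norm_def clip_norm_def)
next
  case False
  then obtain j where j: "\<bar>x j\<bar> > ereal K" by (auto simp: not_le)
  have "K \<le> clip_norm K x"
    using abs_clip_eq[OF j assms] abs_le_L2_set[of "\<lambda>j. clip K (x j)" j] by (simp add: clip_norm_def)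
  with less_le_trans[OF j abs_le_ext_norm[of x j]] show ?thesis by (rule that(2))
qed

lemma clip_norm_less:
  assumes "0 \<le> s" "s < K"
  shows "ereal s < ext_norm x \<longleftrightarrow> s < clip_norm K x"
proof -
  have "0 \<le> K" using assms by linarith
  then show ?thesis
  proof (rule clip_norm_cases[of K x])
    assume *: "ereal K < ext_norm x" "K \<le> clip_norm K x"
    have "ereal s < ereal K" using assms(2) by simp
    from less_trans[OF this *(1)] have "ereal s < ext_norm x" by (simp only: less_imp_le)
    moreover have "s < clip_norm K x" using assms(2) *(2) by linarith
    ultimately show ?thesis by (simp only:)
  next
    assume *: "ext_norm x = ereal (clip_norm K x)"
    show ?thesis unfolding * by simp
  qed
qed

lemma clip_norm_le:
  assumes "0 \<le> s" "s < K"
  shows "ereal s \<le> ext_norm x \<longleftrightarrow> s \<le> clip_norm K x"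
proof -
  have "0 \<le> K" using assms by linarith
  then show ?thesis
  proof (rule clip_norm_cases[of K x])
    assume *: "ereal K < ext_norm x" "K \<le> clip_norm K x"
    have "ereal s < ereal K" using assms(2) by simp
    from less_trans[OF this *(1)] have "ereal s \<le> ext_norm x" by (simp only: less_imp_le)
    moreover have "s \<le> clip_norm K x" using assms(2) *(2) by linarith
    ultimately show ?thesis by (simp only:)
  next
    assume *: "ext_norm x = ereal (clip_norm K x)"
    show ?thesis unfolding * by simp
  qed
qed

lemma continuous_clip_norm: "continuous_on UNIV (clip_norm K)"
  unfolding clip_norm_def L2_set_def
  by (intro continuous_intros continuous_on_compose2[OF continuous_clip[of K]]
      continuous_on_product_coordinates) auto

lemma ext_norm_scale: "t > 0 \<Longrightarrow> ext_norm (\<lambda>j. ereal t * x j) = ereal t * ext_norm x"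
proof -
  assume t: "t > 0"
  have "L2_set (\<lambda>j. real_of_ereal (ereal t * x j)) UNIV = t * L2_set (\<lambda>j. real_of_ereal (x j)) UNIV"
    using t by (simp add: L2_set_right_distrib)
  moreover have "\<bar>ereal t * x j\<bar> \<noteq> \<infinity> \<longleftrightarrow> \<bar>x j\<bar> \<noteq> \<infinity>" for j
    using t by (cases "x j") auto
  ultimately show ?thesis using t by (simp add: ext_norm_def)
qed

lemma ext_norm_ext_vec: "ext_norm (ext_vec x) = ereal (norm x)"
  by (simp add: ext_norm_def ext_vec_def norm_vec_def L2_set_def)

lemma ext_norm_eq_0: "ext_norm x = 0 \<longleftrightarrow> x = (\<lambda>j. 0)"
proof
  assume "ext_norm x = 0"
  then have "\<bar>x j\<bar> \<le> 0" for j using abs_le_ext_norm[of x j] by simp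
  then have "x j = 0" for j using \<open>\<bar>x j\<bar> \<le> 0\<close> by (cases "x j") auto
  then show "x = (\<lambda>j. 0)" by (auto simp: fun_eq_iff)
qed (simp add: ext_norm_def L2_set_def)

lemma ext_norm_nonneg: "0 \<le> ext_norm x"
  by (simp add: ext_norm_def L2_set_nonneg)

lemma topspace_punctured: "topspace (punctured_space h) = ({1..h} \<rightarrow>\<^sub>E UNIV) - {\<lambda>i\<in>{1..h}. \<lambda>j. 0}"
  by (auto simp: punctured_space_def)

lemma continuous_coordinate:
  "i \<in> {1..h} \<Longrightarrow> continuous_map (punctured_space h) euclidean (\<lambda>y. y i)"
  unfolding punctured_space_def
  by (intro continuous_map_from_subtopology) (rule continuous_map_product_projection)

lemma continuous_of_coordinate:
  assumes "i \<in> {1..h}" "continuous_on UNIV f"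
  shows "continuous_map (punctured_space h) euclidean (\<lambda>y. f (y i))"
  using continuous_map_compose[OF continuous_coordinate[OF assms(1)], of euclidean f] assms(2)
  by (simp add: comp_def)

text \<open>The product of copies of the extended line is compact, so a closed set that misses the origin is compact in
  the punctured space.  These sets serve as supports for cut-off functions.\<close>

lemma compact_ext_norm_ge:
  assumes i: "i \<in> {1..h}" and s: "s > 0"
  shows "compactin (punctured_space h) {y :: nat \<Rightarrow> ('d::finite) evec. y \<in> topspace (punctured_space h) \<and> ereal s \<le> ext_norm (y i)}"
proof -
  let ?P = "product_topology (\<lambda>_. euclidean :: ('d evec) topology) {1..h}"
  let ?K = "{y \<in> topspace ?P. s \<le> clip_norm (s + 1) (y i)}"
  have eq: "{y \<in> topspace (punctured_space h). ereal s \<le> ext_norm (y i)} = ?K"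
  proof -
    have "y \<noteq> (\<lambda>i\<in>{1..h}. \<lambda>j. 0)" if "ereal s \<le> ext_norm (y i)" for y :: "nat \<Rightarrow> 'd evec"
    proof
      assume "y = (\<lambda>i\<in>{1..h}. \<lambda>j. 0)"
      then have "ext_norm (y i) = 0" using i by (simp add: ext_norm_eq_0)
      then show False using that s by simp
    qed
    then show ?thesis using s by (auto simp: topspace_punctured clip_norm_le[of s "s + 1"])
  qed
  have "continuous_map ?P euclideanreal (clip_norm (s + 1) \<circ> (\<lambda>y. y i))"
    using i by (intro continuous_map_compose[OF continuous_map_product_projection])
      (auto simp: continuous_clip_norm)
  then have "closedin ?P {y \<in> topspace ?P. (clip_norm (s + 1) \<circ> (\<lambda>y. y i)) y \<in> {s..}}"
    by (rule closedin_continuous_map_preimage) simp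
  then have cl: "closedin ?P ?K" by simp
  have "compact_space (euclidean :: ereal topology)"
    using compact_UNIV[where 'a=ereal] by (simp add: compact_space_def)
  then have "compact_space (euclidean :: ('d evec) topology)"
    unfolding euclidean_product_topology[symmetric] by (simp add: compact_space_product_topology)
  then have "compact_space ?P" by (simp add: compact_space_product_topology)
  then have "compactin ?P ?K" using cl closedin_compact_space by blast
  moreover have "?K \<subseteq> - {\<lambda>i\<in>{1..h}. \<lambda>j. 0}" unfolding eq[symmetric] topspace_punctured by blast
  ultimately show ?thesis unfolding eq by (simp add: punctured_space_def compactin_subtopology)
qed

lemma closed_ext_norm_ge:
  assumes "i \<in> {1..h}" "s \<ge> 0"
  shows "closedin (punctured_space h) {y \<in> topspace (punctured_space h). ereal s \<le> ext_norm (y i)}"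
  using closedin_continuous_map_preimage[OF continuous_of_coordinate[OF assms(1) continuous_clip_norm[of "s+1"]],
      of "{s..}"] assms by (simp add: clip_norm_le[of s "s + 1"])

lemma open_ext_norm_gt:
  assumes "i \<in> {1..h}" "s \<ge> 0"
  shows "openin (punctured_space h) {y \<in> topspace (punctured_space h). ereal s < ext_norm (y i)}"
  using openin_continuous_map_preimage[OF continuous_of_coordinate[OF assms(1) continuous_clip_norm[of "s+1"]],
      of "{s<..}"] assms by (simp add: clip_norm_less[of s "s + 1"])

text \<open>An injection into the countable product \<open>nat \<Rightarrow> 'd \<Rightarrow> nat \<Rightarrow> real\<close>, whose type is a metric space; it plays the
  role of \<open>\<Phi>\<close> in the portmanteau theorem.\<close>

definition clip_embedding :: "nat \<Rightarrow> (nat \<Rightarrow> ('d::finite) evec) \<Rightarrow> nat \<Rightarrow> 'd \<Rightarrow> nat \<Rightarrow> real" where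
  "clip_embedding h y = (\<lambda>i j k. if i \<in> {1..h} then clip (real k) (y i j) else 0)"

lemma continuous_clip_embedding:
  "continuous_map (punctured_space h) euclidean (clip_embedding h :: _ \<Rightarrow> nat \<Rightarrow> 'd::finite \<Rightarrow> nat \<Rightarrow> real)"
proof -
  have "continuous_map (punctured_space h) euclideanreal (\<lambda>y. clip_embedding h y i j k)"
    for i k and j :: 'd
  proof (cases "i \<in> {1..h}")
    case True
    have "continuous_on UNIV (\<lambda>x :: 'd evec. clip (real k) (x j))"
      by (intro continuous_on_compose2[OF continuous_clip] continuous_on_product_coordinates) auto
    from continuous_of_coordinate[OF True this] True show ?thesis by (simp add: clip_embedding_def)
  next
    case False then show ?thesis by (simp only: clip_embedding_def) simp
  qed
  then show ?thesis
    by (simp add: euclidean_product_topology[symmetric] continuous_map_componentwise_UNIV)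
qed

lemma inj_clip_embedding: "inj_on (clip_embedding h) (topspace (punctured_space h))"
proof (rule inj_onI)
  fix y z :: "nat \<Rightarrow> ('d::finite) evec"
  assume y: "y \<in> topspace (punctured_space h)" and z: "z \<in> topspace (punctured_space h)"
    and eq: "clip_embedding h y = clip_embedding h z"
  show "y = z"
  proof (rule PiE_ext)
    show "y \<in> {1..h} \<rightarrow>\<^sub>E UNIV" "z \<in> {1..h} \<rightarrow>\<^sub>E UNIV" using y z by (auto simp: topspace_punctured)
    fix i assume i: "i \<in> {1..h}"
    show "y i = z i"
    proof
      fix j
      have "clip (real k) (y i j) = clip (real k) (z i j)" for k
        using fun_cong[OF fun_cong[OF fun_cong[OF eq, of i], of j], of k] i
        by (simp add: clip_embedding_def)
      then show "y i j = z i j" using clip_separates by blast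
    qed
  qed
qed

text \<open>The cut-off needed for the portmanteau theorem is a piecewise linear function of the truncated norm of one
  entry: 1 from \<open>s\<close> on, and 0 up to \<open>s / 2\<close>.\<close>

lemma portmanteau_punctured:
  fixes \<nu> :: "(nat \<Rightarrow> ('d::finite) evec) measure"
  assumes rad: "radon_measure (punctured_space h) \<nu>" and conv: "vague_conv (punctured_space h) N \<nu> F"
    and N: "\<And>i. finite_measure (N i)" "\<And>i. sets (N i) = sets (borel_of (punctured_space h))"
    and i: "i \<in> {1..h}" and s: "s > 0"
    and A: "A \<in> sets (borel_of (punctured_space h))" "\<And>y. y \<in> A \<Longrightarrow> ereal s \<le> ext_norm (y i)"
      "emeasure \<nu> (punctured_space h frontier_of A) = 0"
  shows "((\<lambda>i. measure (N i) A) \<longlongrightarrow> measure \<nu> A) F" and "emeasure \<nu> A < \<infinity>"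
proof -
  define b where "b y = min 1 (max 0 (2 / s * clip_norm (2 * s) (y i) - 1))" for y :: "nat \<Rightarrow> 'd evec"
  have "continuous_on UNIV (\<lambda>x :: 'd evec. min 1 (max 0 (2 / s * clip_norm (2 * s) x - 1)))"
    by (intro continuous_intros continuous_clip_norm)
  from continuous_of_coordinate[OF i this]
  have b: "continuous_map (punctured_space h) euclideanreal b" unfolding b_def[abs_def] .
  have "{y \<in> topspace (punctured_space h). b y \<noteq> 0}
      \<subseteq> {y \<in> topspace (punctured_space h). ereal (s / 2) \<le> ext_norm (y i)}" 
  proof safe
    fix y assume "b y \<noteq> 0"
    then have "2 / s * clip_norm (2 * s) (y i) > 1" by (auto simp: b_def max_def split: if_splits)
    then have "s / 2 \<le> clip_norm (2 * s) (y i)" using s by (simp add: field_simps)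
    then show "ereal (s / 2) \<le> ext_norm (y i)" using s by (simp add: clip_norm_le[of "s / 2" "2 * s"])
  qed
  then have "punctured_space h closure_of {y \<in> topspace (punctured_space h). b y \<noteq> 0}
      \<subseteq> {y \<in> topspace (punctured_space h). ereal (s / 2) \<le> ext_norm (y i)}"
    using closed_ext_norm_ge[OF i, of "s / 2"] s by (intro closure_of_minimal) auto
  then have bc: "compactin (punctured_space h) (punctured_space h closure_of {y \<in> topspace (punctured_space h). b y \<noteq> 0})"
    using s by (intro closed_compactin[OF compact_ext_norm_ge[OF i, of "s / 2"]]) auto
  have bA: "b y = 1" if "y \<in> A" for y
  proof -
    have "s \<le> clip_norm (2 * s) (y i)" using A(2)[OF that] s by (simp add: clip_norm_le[of s "2 * s"])
    then have "2 / s * clip_norm (2 * s) (y i) - 1 \<ge> 1" using s by (simp add: field_simps)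
    then show ?thesis by (auto simp: b_def)
  qed
  have b01: "0 \<le> b y" "b y \<le> 1" for y by (auto simp: b_def)
  note * = portmanteau_vague[OF continuous_clip_embedding inj_clip_embedding rad conv N b b01 bc A(1) bA A(3)]
  show "((\<lambda>i. measure (N i) A) \<longlongrightarrow> measure \<nu> A) F" and "emeasure \<nu> A < \<infinity>"
    using * by blast+
qed

section \<open>Laws of scaled blocks\<close>

text \<open>The unrestricted family \<open>nat \<Rightarrow> 'd \<Rightarrow> ereal\<close> is measurable coordinate by coordinate, since its type is a
  second countable product; restricting to the block is a continuous map.\<close>

lemma measurable_scaled_block:
  fixes X :: "int \<Rightarrow> 'a \<Rightarrow> real ^ ('d::finite)"
  assumes X: "\<And>t. X t \<in> borel_measurable M"
    and U: "openin (product_topology (\<lambda>_. euclidean) {1..h}) U"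
  shows "{\<omega> \<in> space M. scaled_block X h x \<omega> \<in> U} \<in> sets M"
proof -
  define Y where "Y \<omega> = (\<lambda>i::nat. ext_vec (X (int i) \<omega> /\<^sub>R x))" for \<omega>
  have "(\<lambda>\<omega>. Y \<omega> i j) \<in> borel_measurable M" for i j
  proof -
    have "(\<lambda>\<omega>. X (int i) \<omega> /\<^sub>R x) \<in> borel_measurable M"
      by (rule borel_measurable_scaleR[OF borel_measurable_const X])
    moreover have "continuous_on UNIV (\<lambda>v :: real ^ 'd. v $ j)"
      by (intro continuous_intros)
    ultimately have "(\<lambda>\<omega>. (X (int i) \<omega> /\<^sub>R x) $ j) \<in> borel_measurable M"
      using measurable_compose[OF _ borel_measurable_continuous_onI] by blast
    then show ?thesis unfolding Y_def ext_vec_def by (rule borel_measurable_ereal)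
  qed
  then have Y: "Y \<in> borel_measurable M"
    by (intro measurable_coordinatewise_then_product)
  have "continuous_map (euclidean :: (nat \<Rightarrow> 'd evec) topology) (product_topology (\<lambda>_. euclidean) {1..h})
      (\<lambda>y. restrict y {1..h})"
    unfolding continuous_map_componentwise
    by (auto simp: continuous_on_product_coordinates)
  from openin_continuous_map_preimage[OF this U]
  have "open {y. restrict y {1..h} \<in> U}" by simp
  then have "Y -` {y. restrict y {1..h} \<in> U} \<inter> space M \<in> sets M"
    by (intro measurable_sets[OF Y]) auto
  moreover have "restrict (Y \<omega>) {1..h} = scaled_block X h x \<omega>" for \<omega>
    by (simp add: Y_def scaled_block_def restrict_def)
  then have "Y -` {y. restrict y {1..h} \<in> U} \<inter> space M = {\<omega> \<in> space M. scaled_block X h x \<omega> \<in> U}"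
    by auto
  ultimately show ?thesis by simp
qed

lemma scaled_block_measurable:
  fixes X :: "int \<Rightarrow> 'a \<Rightarrow> real ^ ('d::finite)" and h :: nat and x :: real
  assumes X: "\<And>t. X t \<in> borel_measurable M"
  defines "\<Omega> \<equiv> {\<omega> \<in> space M. scaled_block X h x \<omega> \<in> topspace (punctured_space h)}"
  shows "\<Omega> \<in> sets M"
    and "scaled_block X h x \<in> restrict_space M \<Omega> \<rightarrow>\<^sub>M borel_of (punctured_space h)"
proof -
  let ?P = "product_topology (\<lambda>_. euclidean :: ('d evec) topology) {1..h}"
  let ?z = "\<lambda>i\<in>{1..h}. (\<lambda>j. 0) :: 'd evec"
  have "Hausdorff_space (euclidean :: ereal topology)"
    unfolding Hausdorff_space_def disjnt_def open_openin[symmetric]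
    by (intro allI impI) (rule hausdorff, blast)
  then have "Hausdorff_space (euclidean :: ('d evec) topology)"
    unfolding euclidean_product_topology[symmetric] by (simp add: Hausdorff_space_product_topology)
  then have "Hausdorff_space ?P" by (simp add: Hausdorff_space_product_topology)
  then have "closedin ?P {?z}" by (intro closedin_Hausdorff_singleton) auto
  then have oz: "openin ?P (topspace ?P - {?z})" by blast
  have open_P: "openin ?P U" if "openin (punctured_space h) U" for U
  proof -
    have "openin (subtopology ?P (- {?z})) U" using that by (simp only: punctured_space_def)
    then obtain V where V: "openin ?P V" "U = V \<inter> - {?z}"
      unfolding openin_subtopology by blast
    have "U = V \<inter> (topspace ?P - {?z})" using V openin_subset[OF V(1)] by auto
    then show ?thesis using openin_Int[OF V(1) oz] by simp
  qed
  have open_meas: "{\<omega> \<in> space M. scaled_block X h x \<omega> \<in> U} \<in> sets M"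
    if "openin (punctured_space h) U" for U
    by (rule measurable_scaled_block[OF X open_P[OF that]])
  show \<Omega>: "\<Omega> \<in> sets M" unfolding \<Omega>_def by (rule open_meas) simp
  show "scaled_block X h x \<in> restrict_space M \<Omega> \<rightarrow>\<^sub>M borel_of (punctured_space h)"
    unfolding borel_of_def
  proof (rule measurable_measure_of)
    show "{U. openin (punctured_space h) U} \<subseteq> Pow (topspace (punctured_space h))"
      by (auto dest: openin_subset)
    show "scaled_block X h x \<in> space (restrict_space M \<Omega>) \<rightarrow> topspace (punctured_space h)"
      by (auto simp: space_restrict_space \<Omega>_def)
    fix U :: "(nat \<Rightarrow> 'd evec) set" assume "U \<in> {U. openin (punctured_space h) U}"
    then have U: "openin (punctured_space h) U" by simp
    have "scaled_block X h x -` U \<inter> space (restrict_space M \<Omega>) = \<Omega> \<inter> {\<omega> \<in> space M. scaled_block X h x \<omega> \<in> U}"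
      using sets.sets_into_space[OF \<Omega>] by (auto simp: space_restrict_space)
    then show "scaled_block X h x -` U \<inter> space (restrict_space M \<Omega>) \<in> sets (restrict_space M \<Omega>)"
      using open_meas[OF U] \<Omega> by (auto simp: sets_restrict_space)
  qed
qed

lemma sets_scaled_law: "sets (scaled_law M X h x) = sets (borel_of (punctured_space h))"
  by (simp add: scaled_law_def)

lemma measure_scaled_law:
  fixes X :: "int \<Rightarrow> 'a \<Rightarrow> real ^ ('d::finite)"
  assumes X: "\<And>t. X t \<in> borel_measurable M" and A: "A \<in> sets (borel_of (punctured_space h))"
  shows "measure (scaled_law M X h x) A = measure M {\<omega> \<in> space M. scaled_block X h x \<omega> \<in> A}"
proof -
  define \<Omega> where "\<Omega> = {\<omega> \<in> space M. scaled_block X h x \<omega> \<in> topspace (punctured_space h)}"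
  note m = scaled_block_measurable[where X=X, OF X, where h=h and x=x, folded \<Omega>_def]
  have AT: "A \<subseteq> topspace (punctured_space h)" using sets.sets_into_space[OF A] by (simp add: space_borel_of)
  have eq: "scaled_block X h x -` A \<inter> space (restrict_space M \<Omega>) = {\<omega> \<in> space M. scaled_block X h x \<omega> \<in> A}"
    using AT by (auto simp: space_restrict_space \<Omega>_def)
  have "measure (scaled_law M X h x) A = measure (restrict_space M \<Omega>) {\<omega> \<in> space M. scaled_block X h x \<omega> \<in> A}"
    using measure_distr[OF m(2) A] eq by (simp add: scaled_law_def \<Omega>_def)
  also have "\<dots> = measure M {\<omega> \<in> space M. scaled_block X h x \<omega> \<in> A}"
    using m(1) sets.sets_into_space[OF m(1)] AT by (intro measure_restrict_space) (auto simp: Int_absorb2 \<Omega>_def)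
  finally show ?thesis .
qed

lemma finite_measure_scaled_law:
  fixes X :: "int \<Rightarrow> 'a \<Rightarrow> real ^ ('d::finite)"
  assumes M: "prob_space M" and X: "\<And>t. X t \<in> borel_measurable M"
  shows "finite_measure (scaled_law M X h x)"
proof -
  define \<Omega> where "\<Omega> = {\<omega> \<in> space M. scaled_block X h x \<omega> \<in> topspace (punctured_space h)}"
  note m = scaled_block_measurable[where X=X, OF X, where h=h and x=x, folded \<Omega>_def]
  interpret prob_space M by fact
  have "finite_measure (restrict_space M \<Omega>)"
    using m(1) finite_measure_axioms by (rule_tac finite_measure_restrict_space)
  then show ?thesis unfolding scaled_law_def \<Omega>_def[symmetric]
    by (rule finite_measure.finite_measure_distr) (rule m(2))
qed

lemma finite_measure_scale:
  assumes "finite_measure N" "c < \<infinity>"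
  shows "finite_measure (scale_measure c N)"
  by (rule finite_measureI)
    (use assms finite_measure.emeasure_finite[OF assms(1), of "space N"]
     in \<open>auto simp: space_scale_measure ennreal_mult_eq_top_iff\<close>)

lemma integral_scale_measure:
  fixes f :: "'a \<Rightarrow> real"
  assumes c: "c \<ge> 0" and f: "f \<in> borel_measurable N"
  shows "(\<integral>x. f x \<partial>(scale_measure (ennreal c) N)) = c * (\<integral>x. f x \<partial>N)"
proof -
  have "scale_measure (ennreal c) N = density N (\<lambda>_. ennreal c)"
    by (rule measure_eqI) (auto simp: emeasure_density nn_integral_cmult_indicator)
  then show ?thesis using integral_density[OF f, of "\<lambda>_. c"] c by simp
qed

section \<open>Homogeneous measures on blocks\<close>

lemma in_topspace_punctured:
  assumes "y \<in> {1..h} \<rightarrow>\<^sub>E UNIV" "i \<in> {1..h}" "0 < ext_norm (y i)"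
  shows "y \<in> topspace (punctured_space h)"
proof -
  have "y \<noteq> (\<lambda>i\<in>{1..h}. \<lambda>j. 0)"
  proof
    assume "y = (\<lambda>i\<in>{1..h}. \<lambda>j. 0)"
    then have "y i = (\<lambda>j. 0)" using assms(2) by simp
    then show False using assms(3) ext_norm_eq_0[of "y i"] by simp
  qed
  then show ?thesis using assms(1) by (simp add: topspace_punctured)
qed

lemma dilate_dilate:
  assumes "s * t = 1" "y \<in> {1..h} \<rightarrow>\<^sub>E UNIV"
  shows "dilate h s (dilate h t y) = y"
proof (rule PiE_ext)
  show "dilate h s (dilate h t y) \<in> {1..h} \<rightarrow>\<^sub>E UNIV" by (auto simp: dilate_def)
  fix i assume i: "i \<in> {1..h}"
  have "ereal s * (ereal t * z) = z" for z
    using assms(1) by (simp add: mult.assoc[symmetric] one_ereal_def[symmetric])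
  then show "dilate h s (dilate h t y) i = y i" using i by (simp add: dilate_def)
qed fact

lemma dilate_in_topspace:
  assumes t: "t \<noteq> 0" and y: "y \<in> topspace (punctured_space h)"
  shows "dilate h t y \<in> topspace (punctured_space h)"
proof -
  have "dilate h t y \<noteq> (\<lambda>i\<in>{1..h}. \<lambda>j. 0)"
  proof
    assume *: "dilate h t y = (\<lambda>i\<in>{1..h}. \<lambda>j. 0)"
    have "y = dilate h (1 / t) (dilate h t y)"
      using t y by (intro dilate_dilate[symmetric]) (auto simp: topspace_punctured)
    also have "\<dots> = (\<lambda>i\<in>{1..h}. \<lambda>j. 0)" unfolding * by (auto simp: dilate_def fun_eq_iff)
    finally show False using y by (simp add: topspace_punctured)
  qed
  then show ?thesis by (simp add: topspace_punctured) (simp add: dilate_def)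
qed

lemma dilate_image:
  assumes t: "t > 0" and i: "i \<in> {1..h}"
  shows "dilate h t ` {y \<in> topspace (punctured_space h). P (y i)}
    = {y \<in> topspace (punctured_space h). P (\<lambda>j. ereal (1 / t) * y i j)}"
proof (intro equalityI subsetI)
  fix z assume "z \<in> dilate h t ` {y \<in> topspace (punctured_space h). P (y i)}"
  then obtain y where y: "y \<in> topspace (punctured_space h)" "P (y i)" "z = dilate h t y" by auto
  have "y = dilate h (1 / t) z"
    using t y by (simp add: dilate_dilate topspace_punctured)
  then have "y i = (\<lambda>j. ereal (1 / t) * z i j)" using i by (simp add: dilate_def)
  then show "z \<in> {y \<in> topspace (punctured_space h). P (\<lambda>j. ereal (1 / t) * y i j)}"
    using y dilate_in_topspace[OF _ y(1), of t] t by simp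
next
  fix z assume "z \<in> {y \<in> topspace (punctured_space h). P (\<lambda>j. ereal (1 / t) * y i j)}"
  then have z: "z \<in> topspace (punctured_space h)" "P (\<lambda>j. ereal (1 / t) * z i j)" by auto
  have "z = dilate h t (dilate h (1 / t) z)"
    using t z(1) by (simp add: dilate_dilate topspace_punctured)
  moreover have "dilate h (1 / t) z i = (\<lambda>j. ereal (1 / t) * z i j)"
    using i by (simp add: dilate_def)
  ultimately show "z \<in> dilate h t ` {y \<in> topspace (punctured_space h). P (y i)}"
    using z dilate_in_topspace[OF _ z(1), of "1 / t"] t by (intro image_eqI) auto
qed

lemma ereal_le_scale: "t > 0 \<Longrightarrow> ereal s \<le> ereal (1 / t) * x \<longleftrightarrow> ereal (t * s) \<le> x"
  by (cases x) (auto simp: field_simps)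

lemma ereal_less_scale: "t > 0 \<Longrightarrow> ereal s < ereal (1 / t) * x \<longleftrightarrow> ereal (t * s) < x"
  by (cases x) (auto simp: field_simps)

abbreviation norm_gt :: "nat \<Rightarrow> nat \<Rightarrow> real \<Rightarrow> (nat \<Rightarrow> ('d::finite) evec) set" where
  "norm_gt h i s \<equiv> {y \<in> topspace (punctured_space h). ereal s < ext_norm (y i)}"

abbreviation norm_ge :: "nat \<Rightarrow> nat \<Rightarrow> real \<Rightarrow> (nat \<Rightarrow> ('d::finite) evec) set" where
  "norm_ge h i s \<equiv> {y \<in> topspace (punctured_space h). ereal s \<le> ext_norm (y i)}"

lemma dilate_norm_ge: "t > 0 \<Longrightarrow> i \<in> {1..h} \<Longrightarrow> dilate h t ` norm_ge h i s = norm_ge h i (t * s)"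
  by (subst dilate_image) (auto simp: ext_norm_scale ereal_le_scale)

lemma dilate_norm_gt: "t > 0 \<Longrightarrow> i \<in> {1..h} \<Longrightarrow> dilate h t ` norm_gt h i s = norm_gt h i (t * s)"
  by (subst dilate_image) (auto simp: ext_norm_scale ereal_less_scale)

lemma frontier_norm_gt:
  assumes i: "i \<in> {1..h}" and s: "s \<ge> 0"
  shows "punctured_space h frontier_of norm_gt h i s \<subseteq> norm_ge h i s - norm_gt h i s"
proof -
  have "punctured_space h closure_of norm_gt h i s \<subseteq> norm_ge h i s"
    using closed_ext_norm_ge[OF i s] by (intro closure_of_minimal) auto
  moreover have "punctured_space h interior_of norm_gt h i s = norm_gt h i s"
    by (rule interior_of_openin[OF open_ext_norm_gt[OF i s]])
  ultimately show ?thesis unfolding frontier_of_def by blast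
qed

text \<open>Dilating \<open>{|y\<^sub>i| \<ge> 1}\<close> by factors \<open>t\<close> decreasing to 1 fills up \<open>{|y\<^sub>i| > 1}\<close>, while homogeneity lets the
  measure of the dilated sets tend to that of \<open>{|y\<^sub>i| \<ge> 1}\<close>.  This measure is finite, so the difference of
  the two sets is null.\<close>

lemma homogeneous_sphere_null:
  fixes \<mu> :: "(nat \<Rightarrow> ('d::finite) evec) measure"
  assumes rad: "radon_measure (punctured_space h) \<mu>"
    and hom: "\<And>t B. t > 0 \<Longrightarrow> B \<in> sets \<mu> \<Longrightarrow>
           emeasure \<mu> (dilate h t ` B) = ennreal (t powr (- \<alpha>)) * emeasure \<mu> B"
    and i: "i \<in> {1..h}"
  shows "emeasure \<mu> (punctured_space h frontier_of norm_gt h i 1) = 0"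
proof -
  have S: "sets \<mu> = sets (borel_of (punctured_space h))" using rad by (simp add: radon_measure_def)
  have ge[simp]: "norm_ge h i s \<in> sets \<mu>" if "s \<ge> 0" for s
    using closedin_sets_borel_of[OF closed_ext_norm_ge[OF i that]] S by simp
  have gt[simp]: "norm_gt h i s \<in> sets \<mu>" if "s \<ge> 0" for s
    using openin_sets_borel_of[OF open_ext_norm_gt[OF i that]] S by simp
  have fin: "emeasure \<mu> (norm_ge h i 1) < \<infinity>"
    using rad compact_ext_norm_ge[OF i zero_less_one] unfolding radon_measure_def by blast
  have sub: "norm_gt h i 1 \<subseteq> (norm_ge h i 1 :: (nat \<Rightarrow> 'd evec) set)" by auto
  have fin2: "emeasure \<mu> (norm_gt h i 1) < \<infinity>"
    by (rule le_less_trans[OF emeasure_mono[OF sub] fin]) simp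
  have scale: "measure \<mu> (norm_ge h i t) = t powr (- \<alpha>) * measure \<mu> (norm_ge h i 1)" if "t > 0" for t
  proof -
    have "emeasure \<mu> (norm_ge h i t) = ennreal (t powr (- \<alpha>)) * emeasure \<mu> (norm_ge h i 1)"
      using hom[OF that ge[OF zero_le_one]] by (simp only: dilate_norm_ge[OF that i] mult_1_right)
    then show ?thesis by (simp add: measure_def enn2real_mult)
  qed
  have un: "(\<Union>n. norm_ge h i (1 + inverse (real (Suc n))) :: (nat \<Rightarrow> 'd evec) set) = norm_gt h i 1"
  proof (intro equalityI subsetI)
    fix y :: "nat \<Rightarrow> 'd evec" assume "y \<in> (\<Union>n. norm_ge h i (1 + inverse (real (Suc n))))"
    then obtain n where n: "y \<in> topspace (punctured_space h)" "ereal (1 + inverse (real (Suc n))) \<le> ext_norm (y i)" by auto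
    have "ereal 1 < ereal (1 + inverse (real (Suc n)))" by simp
    from less_le_trans[OF this n(2)] n(1) show "y \<in> norm_gt h i 1" by blast
  next
    fix y :: "nat \<Rightarrow> 'd evec" assume "y \<in> norm_gt h i 1"
    then have y: "y \<in> topspace (punctured_space h)" "ereal 1 < ext_norm (y i)" by auto
    obtain r where r: "1 < r" "ereal r \<le> ext_norm (y i)"
      using ereal_dense2[OF y(2)] by (auto intro: less_imp_le)
    obtain n where "inverse (real (Suc n)) < r - 1" using r(1) reals_Archimedean[of "r - 1"] by auto
    then have "ereal (1 + inverse (real (Suc n))) \<le> ereal r" by simp
    from order.trans[OF this r(2)] y(1) show "y \<in> (\<Union>n. norm_ge h i (1 + inverse (real (Suc n))))" by blast
  qed
  have "incseq (\<lambda>n. norm_ge h i (1 + inverse (real (Suc n))) :: (nat \<Rightarrow> 'd evec) set)"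
  proof (rule monoI, rule subsetI)
    fix m n :: nat and y :: "nat \<Rightarrow> 'd evec" assume mn: "m \<le> n" and y: "y \<in> norm_ge h i (1 + inverse (real (Suc m)))"
    have "ereal (1 + inverse (real (Suc n))) \<le> ereal (1 + inverse (real (Suc m)))"
      using mn by (simp add: le_imp_inverse_le)
    with y show "y \<in> norm_ge h i (1 + inverse (real (Suc n)))" using order.trans by blast
  qed
  then have "(\<lambda>n. measure \<mu> (norm_ge h i (1 + inverse (real (Suc n))))) \<longlonglongrightarrow> measure \<mu> (norm_gt h i 1)"
    using fin2 Lim_measure_incseq[of "\<lambda>n. norm_ge h i (1 + inverse (real (Suc n)))" \<mu>] unfolding un
    by (auto simp: image_subset_iff)
  moreover have "(\<lambda>n. measure \<mu> (norm_ge h i (1 + inverse (real (Suc n)))))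
      \<longlonglongrightarrow> (1 + 0) powr (- \<alpha>) * measure \<mu> (norm_ge h i 1)"
  proof (subst scale)
    show "0 < 1 + inverse (real (Suc n))" for n by (simp add: add_pos_pos)
    show "(\<lambda>n. (1 + inverse (real (Suc n))) powr - \<alpha> * measure \<mu> (norm_ge h i 1))
      \<longlonglongrightarrow> (1 + 0) powr - \<alpha> * measure \<mu> (norm_ge h i 1)"
      by (intro tendsto_intros LIMSEQ_inverse_real_of_nat) simp
  qed
  ultimately have eq: "measure \<mu> (norm_ge h i 1) = measure \<mu> (norm_gt h i 1)"
    using LIMSEQ_unique by fastforce
  then have "emeasure \<mu> (norm_ge h i 1) = emeasure \<mu> (norm_gt h i 1)"
    using fin fin2 by (simp add: emeasure_eq_ennreal_measure)
  then have "emeasure \<mu> (norm_ge h i 1 - norm_gt h i 1) = 0"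
    using sub fin2 by (subst emeasure_Diff) auto
  then show ?thesis
    using emeasure_mono[OF frontier_norm_gt[OF i zero_le_one], of \<mu>]
      sets.Diff[OF ge[OF zero_le_one] gt[OF zero_le_one]] by simp
qed

section \<open>Stationary sequences and the ratio of norm tails\<close>

locale stationary_sequence = prob_space M
  for M :: "'a measure" +
  fixes X :: "int \<Rightarrow> 'a \<Rightarrow> real ^ ('d::finite)"
  assumes X_measurable: "\<And>t. X t \<in> borel_measurable M"
    and stationary: "strictly_stationary M X"
begin

lemma X_event:
  assumes "B \<in> sets borel"
  shows "{\<omega> \<in> space M. X t \<omega> \<in> B} \<in> events"
  using measurable_sets[OF X_measurable assms, of t] by (simp add: vimage_def Int_def conj_commute)

lemma prob_pair_shift:
  assumes B: "B \<in> sets borel" "B' \<in> sets borel"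
  shows "prob {\<omega> \<in> space M. X (s + k) \<omega> \<in> B \<and> X (t + k) \<omega> \<in> B'}
    = prob {\<omega> \<in> space M. X s \<omega> \<in> B \<and> X t \<omega> \<in> B'}"
proof -
  let ?J = "{s, t}"
  let ?P = "\<Pi>\<^sub>M t\<in>?J. (borel :: (real ^ 'd) measure)"
  define E where "E = {f \<in> space ?P. f s \<in> B \<and> f t \<in> B'}"
  have "{f \<in> space ?P. f s \<in> B} \<in> sets ?P" "{f \<in> space ?P. f t \<in> B'} \<in> sets ?P"
    using measurable_sets[OF measurable_component_singleton[of s ?J "\<lambda>_. borel :: (real ^ 'd) measure"] B(1)]
      measurable_sets[OF measurable_component_singleton[of t ?J "\<lambda>_. borel :: (real ^ 'd) measure"] B(2)]
    by (auto simp: vimage_def Int_def conj_commute)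
  moreover have "E = {f \<in> space ?P. f s \<in> B} \<inter> {f \<in> space ?P. f t \<in> B'}" by (auto simp: E_def)
  ultimately have E: "E \<in> sets ?P" by auto
  have law: "measure (distr M ?P (\<lambda>\<omega>. \<lambda>t\<in>?J. X (t + j) \<omega>)) E
      = prob {\<omega> \<in> space M. X (s + j) \<omega> \<in> B \<and> X (t + j) \<omega> \<in> B'}" for j
  proof -
    have m: "(\<lambda>\<omega>. \<lambda>t\<in>?J. X (t + j) \<omega>) \<in> M \<rightarrow>\<^sub>M ?P"
      by (rule measurable_restrict) (rule X_measurable)
    have "(\<lambda>\<omega>. \<lambda>t\<in>?J. X (t + j) \<omega>) -` E \<inter> space M = {\<omega> \<in> space M. X (s + j) \<omega> \<in> B \<and> X (t + j) \<omega> \<in> B'}"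
      by (auto simp: E_def space_PiM)
    then show ?thesis using measure_distr[OF m E] by simp
  qed
  have eq: "distr M ?P (\<lambda>\<omega>. \<lambda>t\<in>?J. X (t + k) \<omega>) = distr M ?P (\<lambda>\<omega>. \<lambda>t\<in>?J. X t \<omega>)"
    by (rule stationary[unfolded strictly_stationary_def, rule_format]) simp
  show ?thesis
    using law[of k] law[of 0] unfolding eq by (simp only: add_0_right)
qed

lemma prob_shift:
  assumes B: "B \<in> sets borel"
  shows "prob {\<omega> \<in> space M. X t \<omega> \<in> B} = prob {\<omega> \<in> space M. X 0 \<omega> \<in> B}"
  using prob_pair_shift[OF B B, of 0 t 0] by simp

lemma prob_pair_lag:
  assumes B: "B \<in> sets borel" "B' \<in> sets borel"
  shows "prob {\<omega> \<in> space M. X s \<omega> \<in> B \<and> X t \<omega> \<in> B'}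
    = prob {\<omega> \<in> space M. X 0 \<omega> \<in> B \<and> X (t - s) \<omega> \<in> B'}"
  using prob_pair_shift[OF B, of 0 s "t - s"] by simp

lemma prob_scaled_block_norm_gt:
  assumes "i \<in> {1..h}" "x > 0"
  shows "measure (scaled_law M X h x) (norm_gt h i 1) = prob {\<omega> \<in> space M. norm (X 0 \<omega>) > x}"
proof -
  have "scaled_block X h x \<omega> \<in> norm_gt h i 1 \<longleftrightarrow> X (int i) \<omega> \<in> {v. norm v > x}" for \<omega>
  proof -
    have n: "ext_norm (scaled_block X h x \<omega> i) = ereal (norm (X (int i) \<omega>) / x)"
      using assms by (simp add: scaled_block_def ext_norm_ext_vec divide_inverse_commute)
    have "scaled_block X h x \<omega> \<in> {1..h} \<rightarrow>\<^sub>E UNIV" by (simp add: scaled_block_def)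
    then have "scaled_block X h x \<omega> \<in> topspace (punctured_space h)" if "1 < norm (X (int i) \<omega>) / x"
      using that n by (intro in_topspace_punctured[OF _ assms(1)]) simp_all
    then have "scaled_block X h x \<omega> \<in> norm_gt h i 1 \<longleftrightarrow> 1 < norm (X (int i) \<omega>) / x"
      using n by auto
    then show ?thesis using assms by (simp add: less_divide_eq)
  qed
  then have "measure (scaled_law M X h x) (norm_gt h i 1) = prob {\<omega> \<in> space M. X (int i) \<omega> \<in> {v. norm v > x}}"
    using openin_sets_borel_of[OF open_ext_norm_gt[OF assms(1), of 1]]
    by (subst measure_scaled_law[where X=X, OF X_measurable]) auto
  also have "{v :: real ^ 'd. norm v > x} \<in> sets borel" by measurable
  then have "prob {\<omega> \<in> space M. X (int i) \<omega> \<in> {v. norm v > x}} = prob {\<omega> \<in> space M. X 0 \<omega> \<in> {v. norm v > x}}"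
    by (rule prob_shift)
  finally show ?thesis by simp
qed

lemma finite_scaled_law: "finite_measure (scaled_law M X h x)"
  by (rule finite_measure_scaled_law[OF prob_space_axioms X_measurable])

text \<open>By stationarity the limit of the ratio is the mass of \<open>{|y\<^sub>i| > 1}\<close> for every \<open>i\<close>.  Were it 0, homogeneity
  would give every \<open>{|y\<^sub>i| > s}\<close> mass 0, and these sets exhaust the punctured space.\<close>

lemma norm_tail_ratio:
  assumes rad: "radon_measure (punctured_space h) \<mu>"
    and h: "h \<ge> 1" and nz: "emeasure \<mu> (space \<mu>) \<noteq> 0"
    and hom: "\<And>t B. t > 0 \<Longrightarrow> B \<in> sets \<mu> \<Longrightarrow>
           emeasure \<mu> (dilate h t ` B) = ennreal (t powr (- \<alpha>)) * emeasure \<mu> B"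
    and conv: "vague_conv (punctured_space h)
          (\<lambda>x. scale_measure (ennreal (1 / prob {\<omega> \<in> space M. block_norm X h \<omega> > x}))
                 (scaled_law M X h x)) \<mu> at_top"
  shows "\<exists>q>0. ((\<lambda>x. prob {\<omega> \<in> space M. norm (X 0 \<omega>) > x} /
                     prob {\<omega> \<in> space M. block_norm X h \<omega> > x}) \<longlongrightarrow> q) at_top"
proof -
  let ?N = "\<lambda>x. scale_measure (ennreal (1 / prob {\<omega> \<in> space M. block_norm X h \<omega> > x})) (scaled_law M X h x)"
  have S: "sets \<mu> = sets (borel_of (punctured_space h))" using rad by (simp add: radon_measure_def)
  have sp: "space \<mu> = topspace (punctured_space h)" using sets_eq_imp_space_eq[OF S] by (simp add: space_borel_of)
  have gt: "norm_gt h i s \<in> sets (borel_of (punctured_space h))" if "i \<in> {1..h}" "s \<ge> 0" for i s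
    using openin_sets_borel_of[OF open_ext_norm_gt[OF that]] .
  have lim: "((\<lambda>x. prob {\<omega> \<in> space M. norm (X 0 \<omega>) > x} / prob {\<omega> \<in> space M. block_norm X h \<omega> > x})
        \<longlongrightarrow> measure \<mu> (norm_gt h i 1)) at_top"
    and fin: "emeasure \<mu> (norm_gt h i 1) < \<infinity>" if i: "i \<in> {1..h}" for i
  proof -
    have N: "finite_measure (?N x)" "sets (?N x) = sets (borel_of (punctured_space h))" for x
      by (auto simp: sets_scaled_law intro!: finite_measure_scale finite_scaled_law)
    have A: "ereal 1 \<le> ext_norm (y i)" if "y \<in> norm_gt h i 1" for y
      using that less_imp_le by blast
    have Z: "emeasure \<mu> (punctured_space h frontier_of norm_gt h i 1) = 0"
      by (rule homogeneous_sphere_null[OF rad _ i]) (rule hom)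
    show "emeasure \<mu> (norm_gt h i 1) < \<infinity>"
      by (rule portmanteau_punctured(2)[OF rad conv])
        (rule N i zero_less_one gt[OF i zero_le_one] A Z | assumption)+
    have "((\<lambda>x. measure (?N x) (norm_gt h i 1)) \<longlongrightarrow> measure \<mu> (norm_gt h i 1)) at_top"
      by (rule portmanteau_punctured(1)[OF rad conv])
        (rule N i zero_less_one gt[OF i zero_le_one] A Z | assumption)+
    moreover have "\<forall>\<^sub>F x in at_top. measure (?N x) (norm_gt h i 1)
        = prob {\<omega> \<in> space M. norm (X 0 \<omega>) > x} / prob {\<omega> \<in> space M. block_norm X h \<omega> > x}"
      using eventually_gt_at_top[of 0]
    proof eventually_elim
      case (elim x)
      have "0 \<le> 1 / prob {\<omega> \<in> space M. block_norm X h \<omega> > x}" by simp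
      from measure_scale_measure[OF this] show ?case
        unfolding prob_scaled_block_norm_gt[OF i elim, symmetric] by simp
    qed
    ultimately show "((\<lambda>x. prob {\<omega> \<in> space M. norm (X 0 \<omega>) > x} / prob {\<omega> \<in> space M. block_norm X h \<omega> > x})
        \<longlongrightarrow> measure \<mu> (norm_gt h i 1)) at_top"
      by (rule Lim_transform_eventually)
  qed
  define q where "q = measure \<mu> (norm_gt h 1 1)"
  have q: "measure \<mu> (norm_gt h i 1) = q" if "i \<in> {1..h}" for i
    unfolding q_def using lim[OF that] lim[of 1] h by (intro tendsto_unique[OF _ lim[OF that] lim[of 1]]) auto
  have "q \<noteq> 0"
  proof
    assume "q = 0"
    then have 0: "emeasure \<mu> (norm_gt h i 1) = 0" if "i \<in> {1..h}" for i
      using fin[OF that] q[OF that] by (simp add: emeasure_eq_ennreal_measure)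
    have null: "norm_gt h i s \<in> null_sets \<mu>" if i: "i \<in> {1..h}" and s: "s > 0" for i s
    proof (rule null_setsI)
      have "emeasure \<mu> (norm_gt h i s) = emeasure \<mu> (dilate h s ` norm_gt h i 1)"
        by (simp only: dilate_norm_gt[OF s i] mult_1_right)
      also have "\<dots> = ennreal (s powr (- \<alpha>)) * emeasure \<mu> (norm_gt h i 1)"
        using gt[OF i, of 1] S by (intro hom s) auto
      finally show "emeasure \<mu> (norm_gt h i s) = 0" using 0[OF i] by simp
    qed (use gt[OF i, of s] s S in auto)
    have "topspace (punctured_space h :: (nat \<Rightarrow> 'd evec) topology) \<subseteq> (\<Union>i\<in>{1..h}. \<Union>n. norm_gt h i (inverse (real (Suc n))))"
    proof
      fix y :: "nat \<Rightarrow> 'd evec" assume y: "y \<in> topspace (punctured_space h)"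
      have "\<exists>i\<in>{1..h}. y i \<noteq> (\<lambda>j. 0)"
      proof (rule ccontr)
        assume n: "\<not> ?thesis"
        have "y = (\<lambda>i\<in>{1..h}. \<lambda>j. 0)"
          by (rule PiE_ext[of _ "{1..h}" "\<lambda>_. UNIV"]) (use n y in \<open>auto simp: topspace_punctured\<close>)
        then show False using y by (simp add: topspace_punctured)
      qed
      then obtain i where i: "i \<in> {1..h}" "y i \<noteq> (\<lambda>j. 0)" by blast
      then have "0 < ext_norm (y i)" using ext_norm_nonneg[of "y i"] ext_norm_eq_0[of "y i"] by (simp add: less_le)
      then obtain r where r: "0 < ereal r" "ereal r < ext_norm (y i)" using ereal_dense2[OF \<open>0 < ext_norm (y i)\<close>] by auto
      obtain n where "inverse (real (Suc n)) < r" using r(1) reals_Archimedean[of r] by auto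
      then have "ereal (inverse (real (Suc n))) < ext_norm (y i)" using r(2) less_trans[of "ereal (inverse (real (Suc n)))" "ereal r"] by simp
      then show "y \<in> (\<Union>i\<in>{1..h}. \<Union>n. norm_gt h i (inverse (real (Suc n))))" using i y by blast
    qed
    moreover have "(\<Union>i\<in>{1..h}. \<Union>n. norm_gt h i (inverse (real (Suc n)))) \<in> null_sets \<mu>"
      by (intro null_sets_UN' null null_sets_UN) auto
    ultimately have "emeasure \<mu> (topspace (punctured_space h)) \<le> 0"
      by (metis (no_types, lifting) emeasure_mono null_setsD1 null_setsD2)
    then show False using nz sp by simp
  qed
  then have "q > 0" by (simp add: q_def less_le)
  then show ?thesis using lim[of 1] h unfolding q_def by auto
qed

end

section \<open>Tail limits of a regularly varying sequence\<close>

locale regularly_varying_sequence = stationary_sequence M X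
  for M :: "'a measure" and X :: "int \<Rightarrow> 'a \<Rightarrow> real ^ ('d::finite)" +
  fixes \<alpha> :: real and a :: "nat \<Rightarrow> real"
  assumes reg_var: "regularly_varying M X \<alpha>"
    and a_at_top: "filterlim a at_top sequentially"
    and a_tail: "(\<lambda>n. measure M {\<omega> \<in> space M. norm (X 0 \<omega>) > a n}) \<sim>[sequentially] (\<lambda>n. 1 / real n)"
begin

lemma norm_tail_tendsto: "(\<lambda>n. real n * prob {\<omega> \<in> space M. norm (X 0 \<omega>) > a n}) \<longlonglongrightarrow> 1"
proof -
  let ?g = "\<lambda>n. prob {\<omega> \<in> space M. norm (X 0 \<omega>) > a n}"
  have "(\<lambda>n. if ?g n = 0 \<and> 1 / real n = 0 then 1 else ?g n / (1 / real n)) \<longlonglongrightarrow> 1"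
    using a_tail unfolding asymp_equiv_def .
  moreover have "\<forall>\<^sub>F n in sequentially. (if ?g n = 0 \<and> 1 / real n = 0 then 1 else ?g n / (1 / real n)) = real n * ?g n"
    using eventually_gt_at_top[of 0] by eventually_elim auto
  ultimately show ?thesis by (rule Lim_transform_eventually)
qed

lemma block_norm_tail_tendsto:
  assumes q: "q > 0"
    and ratio: "((\<lambda>x. prob {\<omega> \<in> space M. norm (X 0 \<omega>) > x} / prob {\<omega> \<in> space M. block_norm X h \<omega> > x}) \<longlongrightarrow> q) at_top"
  shows "(\<lambda>n. real n * prob {\<omega> \<in> space M. block_norm X h \<omega> > a n}) \<longlonglongrightarrow> 1 / q"
    and "\<forall>\<^sub>F n in sequentially. prob {\<omega> \<in> space M. block_norm X h \<omega> > a n} \<noteq> 0"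
proof -
  let ?g = "\<lambda>n. prob {\<omega> \<in> space M. norm (X 0 \<omega>) > a n}"
  let ?b = "\<lambda>n. prob {\<omega> \<in> space M. block_norm X h \<omega> > a n}"
  have r: "(\<lambda>n. ?g n / ?b n) \<longlonglongrightarrow> q" by (rule filterlim_compose[OF ratio a_at_top])
  have ev: "\<forall>\<^sub>F n in sequentially. 0 < ?g n / ?b n" by (rule order_tendstoD(1)[OF r q])
  then show "\<forall>\<^sub>F n in sequentially. ?b n \<noteq> 0" by eventually_elim auto
  have "(\<lambda>n. real n * ?g n / (?g n / ?b n)) \<longlonglongrightarrow> 1 / q"
    using q by (intro tendsto_divide norm_tail_tendsto r) simp
  moreover have "\<forall>\<^sub>F n in sequentially. real n * ?g n / (?g n / ?b n) = real n * ?b n"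
    using ev by eventually_elim auto
  ultimately show "(\<lambda>n. real n * ?b n) \<longlonglongrightarrow> 1 / q" by (rule Lim_transform_eventually)
qed

text \<open>A positive multiple of the limit measure of regular variation works, because \<open>n P(|(X\<^sub>1, \<dots>, X\<^sub>h)| > a\<^sub>n)\<close>
  has a positive limit.\<close>

lemma tail_limit_exists:
  assumes h: "h \<ge> 1"
  shows "\<exists>\<nu>. radon_measure (punctured_space h) \<nu> \<and>
        vague_conv (punctured_space h) (\<lambda>n. scale_measure (of_nat n) (scaled_law M X h (a n))) \<nu> sequentially"
proof -
  obtain \<mu> where rad: "radon_measure (punctured_space h) \<mu>"
    and nz: "emeasure \<mu> (space \<mu>) \<noteq> 0"
    and hom: "\<And>t B. t > 0 \<Longrightarrow> B \<in> sets \<mu> \<Longrightarrow>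
           emeasure \<mu> (dilate h t ` B) = ennreal (t powr (- \<alpha>)) * emeasure \<mu> B"
    and conv: "vague_conv (punctured_space h)
          (\<lambda>x. scale_measure (ennreal (1 / prob {\<omega> \<in> space M. block_norm X h \<omega> > x}))
                 (scaled_law M X h x)) \<mu> at_top"
    using reg_var h unfolding regularly_varying_def by blast
  let ?b = "\<lambda>n. prob {\<omega> \<in> space M. block_norm X h \<omega> > a n}"
  obtain q where q: "q > 0"
    and ratio: "((\<lambda>x. prob {\<omega> \<in> space M. norm (X 0 \<omega>) > x} / prob {\<omega> \<in> space M. block_norm X h \<omega> > x}) \<longlongrightarrow> q) at_top"
    using norm_tail_ratio[OF rad h nz _ conv, of \<alpha>] hom by blast
  note b = block_norm_tail_tendsto[OF q ratio]
  have S: "sets \<mu> = sets (borel_of (punctured_space h))" using rad by (simp add: radon_measure_def)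
  show ?thesis
  proof (intro exI conjI)
    show "radon_measure (punctured_space h) (scale_measure (ennreal (1 / q)) \<mu>)"
      using rad by (auto simp: radon_measure_def ennreal_mult_less_top)
    show "vague_conv (punctured_space h) (\<lambda>n. scale_measure (of_nat n) (scaled_law M X h (a n)))
        (scale_measure (ennreal (1 / q)) \<mu>) sequentially"
      unfolding vague_conv_def
    proof (intro allI impI)
      fix f :: "(nat \<Rightarrow> 'd evec) \<Rightarrow> real"
      assume f: "continuous_map (punctured_space h) euclideanreal f \<and>
        compactin (punctured_space h) (punctured_space h closure_of {x \<in> topspace (punctured_space h). f x \<noteq> 0})"
      have fm: "f \<in> borel_measurable \<mu>" "f \<in> borel_measurable (scaled_law M X h x)" for x
        using f by (auto intro: borel_measurable_continuous_map simp: S sets_scaled_law)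
      let ?I = "\<lambda>n. \<integral>y. f y \<partial>(scaled_law M X h (a n))"
      have "((\<lambda>x. \<integral>y. f y \<partial>(scale_measure (ennreal (1 / prob {\<omega> \<in> space M. block_norm X h \<omega> > x})) (scaled_law M X h x)))
          \<longlongrightarrow> (\<integral>y. f y \<partial>\<mu>)) at_top"
        using conv f unfolding vague_conv_def by blast
      then have "((\<lambda>x. 1 / prob {\<omega> \<in> space M. block_norm X h \<omega> > x} * (\<integral>y. f y \<partial>(scaled_law M X h x)))
          \<longlongrightarrow> (\<integral>y. f y \<partial>\<mu>)) at_top"
        by (simp add: integral_scale_measure[OF _ fm(2)])
      from filterlim_compose[OF this a_at_top]
      have "(\<lambda>n. 1 / ?b n * ?I n) \<longlonglongrightarrow> (\<integral>y. f y \<partial>\<mu>)" .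
      from tendsto_mult[OF b(1) this]
      have "(\<lambda>n. real n * ?b n * (1 / ?b n * ?I n)) \<longlonglongrightarrow> 1 / q * (\<integral>y. f y \<partial>\<mu>)" .
      moreover have "\<forall>\<^sub>F n in sequentially. real n * ?b n * (1 / ?b n * ?I n) = real n * ?I n"
        using b(2) by eventually_elim simp
      ultimately have "(\<lambda>n. real n * ?I n) \<longlonglongrightarrow> 1 / q * (\<integral>y. f y \<partial>\<mu>)"
        by (rule Lim_transform_eventually)
      moreover have "(\<integral>y. f y \<partial>(scale_measure (of_nat n) (scaled_law M X h (a n)))) = real n * ?I n" for n
        using integral_scale_measure[OF _ fm(2), of "real n"] by (simp add: ennreal_of_nat_eq_real_of_nat)
      ultimately show "(\<lambda>n. \<integral>y. f y \<partial>(scale_measure (of_nat n) (scaled_law M X h (a n))))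
          \<longlonglongrightarrow> (\<integral>y. f y \<partial>(scale_measure (ennreal (1 / q)) \<mu>))"
        using q by (simp add: integral_scale_measure[OF _ fm(1)])
    qed
  qed
qed

lemma tail_limit_radon_vague:
  assumes "h \<ge> 1"
  shows "radon_measure (punctured_space h) (tail_limit M X a h)"
    and "vague_conv (punctured_space h) (\<lambda>n. scale_measure (of_nat n) (scaled_law M X h (a n)))
           (tail_limit M X a h) sequentially"
  using someI_ex[OF tail_limit_exists[OF assms]] unfolding tail_limit_def by blast+

lemma tail_limit_tendsto:
  assumes h: "h \<ge> 1" and i: "i \<in> {1..h}" and s: "s > 0"
    and A: "A \<in> sets (borel_of (punctured_space h))" "\<And>y. y \<in> A \<Longrightarrow> ereal s \<le> ext_norm (y i)"
      "emeasure (tail_limit M X a h) (punctured_space h frontier_of A) = 0"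
  shows "(\<lambda>n. real n * prob {\<omega> \<in> space M. scaled_block X h (a n) \<omega> \<in> A}) \<longlonglongrightarrow> measure (tail_limit M X a h) A"
proof -
  let ?N = "\<lambda>n. scale_measure (of_nat n) (scaled_law M X h (a n))"
  have N: "finite_measure (?N n)" "sets (?N n) = sets (borel_of (punctured_space h))" for n
    by (auto simp: sets_scaled_law of_nat_less_top intro!: finite_measure_scale finite_scaled_law)
  have "(\<lambda>n. measure (?N n) A) \<longlonglongrightarrow> measure (tail_limit M X a h) A"
    by (rule portmanteau_punctured(1)[OF tail_limit_radon_vague[OF h]]) (rule N i s A | assumption)+
  moreover have "measure (?N n) A = real n * prob {\<omega> \<in> space M. scaled_block X h (a n) \<omega> \<in> A}" for n
    using measure_scale_measure[of "real n" "scaled_law M X h (a n)" A]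
      measure_scaled_law[where X=X, OF X_measurable A(1)]
    by (simp add: ennreal_of_nat_eq_real_of_nat)
  ultimately show ?thesis by simp
qed

lemma vimage_ext_vec_borel:
  assumes "C \<in> sets borel"
  shows "{v :: real ^ 'd. ext_vec (v /\<^sub>R x) \<in> C} \<in> sets borel"
proof -
  have "(\<lambda>v :: real ^ 'd. ext_vec (v /\<^sub>R x)) \<in> borel_measurable borel"
  proof (intro measurable_coordinatewise_then_product)
    fix j :: 'd
    have "continuous_on UNIV (\<lambda>v :: real ^ 'd. (v /\<^sub>R x) $ j)" by (intro continuous_intros)
    then have "(\<lambda>v :: real ^ 'd. (v /\<^sub>R x) $ j) \<in> borel_measurable borel"
      by (rule borel_measurable_continuous_onI)
    then show "(\<lambda>v :: real ^ 'd. ext_vec (v /\<^sub>R x) j) \<in> borel_measurable borel"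
      unfolding ext_vec_def by (rule borel_measurable_ereal)
  qed
  from measurable_sets[OF this assms] show ?thesis by (simp add: vimage_def)
qed

lemma coordinate_measurable:
  assumes "i \<in> {1..h}" "sets \<nu> = sets (borel_of (punctured_space h))"
  shows "(\<lambda>y. y i) \<in> borel_measurable \<nu>"
  by (rule borel_measurable_continuous_map[OF continuous_coordinate[OF assms(1)] assms(2)])

lemma scaled_block_coordinate: "i \<in> {1..h} \<Longrightarrow> scaled_block X h x \<omega> i = ext_vec (X (int i) \<omega> /\<^sub>R x)"
  by (simp add: scaled_block_def)

lemma tail_measure_tendsto:
  assumes C: "C \<in> sets borel" and bd: "bounded_away_from_zero C"
    and fr: "emeasure (tail_measure M X a) (frontier C) = 0"
  shows "(\<lambda>n. real n * prob {\<omega> \<in> space M. ext_vec (X 0 \<omega> /\<^sub>R a n) \<in> C}) \<longlonglongrightarrow> measure (tail_measure M X a) C"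
proof -
  let ?\<nu> = "tail_limit M X a 1"
  let ?T = "punctured_space 1 :: (nat \<Rightarrow> 'd evec) topology"
  obtain s where s: "s > 0" "\<And>x. x \<in> C \<Longrightarrow> ereal s < ext_norm x"
    using bd by (auto simp: bounded_away_from_zero_def)
  have S: "sets ?\<nu> = sets (borel_of ?T)"
    using tail_limit_radon_vague(1)[of 1] by (simp add: radon_measure_def)
  have sp: "space ?\<nu> = topspace ?T" using sets_eq_imp_space_eq[OF S] by (simp add: space_borel_of)
  have one: "(1::nat) \<in> {1..1}" by simp
  have m: "(\<lambda>y. y 1) \<in> borel_measurable ?\<nu>" by (rule coordinate_measurable[OF one S])
  define A where "A = {y \<in> topspace ?T. y 1 \<in> C}"
  have A: "A \<in> sets (borel_of ?T)"
    using measurable_sets[OF m C] S sp by (simp add: A_def vimage_def Int_def conj_commute)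
  have "?T frontier_of A \<subseteq> {y \<in> topspace ?T. y 1 \<in> frontier C}"
    unfolding A_def using continuous_map_frontier_frontier_preimage_subset[OF continuous_coordinate[OF one]] by simp
  also have "\<dots> = (\<lambda>y. y 1) -` frontier C \<inter> space ?\<nu>" using sp by auto
  finally have "emeasure ?\<nu> (?T frontier_of A) \<le> emeasure ?\<nu> ((\<lambda>y. y 1) -` frontier C \<inter> space ?\<nu>)"
    by (rule emeasure_mono) (rule measurable_sets[OF m], simp add: frontier_closed borel_closed)
  also have "\<dots> = 0"
    using fr emeasure_distr[OF m, of "frontier C"] by (simp add: tail_measure_def frontier_closed borel_closed)
  finally have "emeasure ?\<nu> (?T frontier_of A) = 0" by simp
  from tail_limit_tendsto[OF _ one s(1) A _ this]
  have lim: "(\<lambda>n. real n * prob {\<omega> \<in> space M. scaled_block X 1 (a n) \<omega> \<in> A}) \<longlonglongrightarrow> measure ?\<nu> A"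
    using s(2) less_imp_le by (auto simp: A_def)
  have "measure ?\<nu> A = measure (tail_measure M X a) C"
    unfolding tail_measure_def measure_distr[OF m C] using sp by (simp add: A_def vimage_def Int_def conj_commute)
  moreover have "prob {\<omega> \<in> space M. scaled_block X 1 (a n) \<omega> \<in> A} = prob {\<omega> \<in> space M. ext_vec (X 0 \<omega> /\<^sub>R a n) \<in> C}" for n
  proof -
    have "scaled_block X 1 (a n) \<omega> \<in> A \<longleftrightarrow> X 1 \<omega> \<in> {v. ext_vec (v /\<^sub>R a n) \<in> C}" for \<omega>
    proof -
      have c: "scaled_block X 1 (a n) \<omega> 1 = ext_vec (X 1 \<omega> /\<^sub>R a n)" using scaled_block_coordinate[OF one] by simp
      have "scaled_block X 1 (a n) \<omega> \<in> topspace ?T" if "ext_vec (X 1 \<omega> /\<^sub>R a n) \<in> C"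
      proof (rule in_topspace_punctured[OF _ one])
        show "0 < ext_norm (scaled_block X 1 (a n) \<omega> 1)"
          using s(2)[OF that] s(1) less_trans[of 0 "ereal s"] unfolding c by simp
      qed (simp add: scaled_block_def)
      then show ?thesis using c by (auto simp: A_def)
    qed
    then show ?thesis using prob_shift[OF vimage_ext_vec_borel[OF C], of 1 "a n"] by simp
  qed
  ultimately show ?thesis using lim by simp
qed

text \<open>The block \<open>X\<^sub>1, \<dots>, X\<^sub>h\<^sub>+\<^sub>1\<close> that defines the tail limit is shifted by one to start at time 0.\<close>

lemma tau_tendsto:
  assumes C: "C \<in> sets borel" and bd: "bounded_away_from_zero C" and h: "h \<ge> 1"
    and fr: "emeasure (tail_limit M X a (h + 1)) (punctured_space (h + 1) frontier_of end_cylinder h C) = 0"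
  shows "(\<lambda>n. real n * prob {\<omega> \<in> space M. ext_vec (X 0 \<omega> /\<^sub>R a n) \<in> C \<and> ext_vec (X (int h) \<omega> /\<^sub>R a n) \<in> C})
    \<longlonglongrightarrow> tau M X a C h"
proof -
  let ?\<nu> = "tail_limit M X a (h + 1)"
  let ?T = "punctured_space (h + 1) :: (nat \<Rightarrow> 'd evec) topology"
  obtain s where s: "s > 0" "\<And>x. x \<in> C \<Longrightarrow> ereal s < ext_norm x"
    using bd by (auto simp: bounded_away_from_zero_def)
  have one: "(1::nat) \<in> {1..h + 1}" "h + 1 \<in> {1..h + 1}" by auto
  have pos: "0 < ext_norm x" if "x \<in> C" for x
    using s(2)[OF that] s(1) less_trans[of 0 "ereal s"] by simp
  have top: "y \<in> topspace ?T" if "y \<in> end_cylinder h C" for y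
    using that pos by (intro in_topspace_punctured[OF _ one(1)]) (auto simp: end_cylinder_def)
  have pieces: "{y \<in> topspace ?T. y i \<in> C} \<in> sets (borel_of ?T)" if "i \<in> {1..h + 1}" for i
    using measurable_sets[OF coordinate_measurable[OF that refl] C]
    by (simp add: space_borel_of vimage_def Int_def conj_commute)
  have "end_cylinder h C = {y \<in> topspace ?T. y 1 \<in> C} \<inter> {y \<in> topspace ?T. y (h + 1) \<in> C}"
    using top by (auto simp: end_cylinder_def topspace_punctured)
  then have A: "end_cylinder h C \<in> sets (borel_of ?T)" using pieces one by auto
  have "(\<lambda>n. real n * prob {\<omega> \<in> space M. scaled_block X (h + 1) (a n) \<omega> \<in> end_cylinder h C}) \<longlonglongrightarrow> measure ?\<nu> (end_cylinder h C)"
    using s(2) less_imp_le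
    by (intro tail_limit_tendsto[OF _ one(1) s(1) A _ fr]) (auto simp: end_cylinder_def)
  moreover have "prob {\<omega> \<in> space M. scaled_block X (h + 1) (a n) \<omega> \<in> end_cylinder h C}
     = prob {\<omega> \<in> space M. ext_vec (X 0 \<omega> /\<^sub>R a n) \<in> C \<and> ext_vec (X (int h) \<omega> /\<^sub>R a n) \<in> C}" for n
  proof -
    let ?B = "{v :: real ^ 'd. ext_vec (v /\<^sub>R a n) \<in> C}"
    have "scaled_block X (h + 1) (a n) \<omega> \<in> {1..h + 1} \<rightarrow>\<^sub>E UNIV" for \<omega> by (simp add: scaled_block_def)
    then have "scaled_block X (h + 1) (a n) \<omega> \<in> end_cylinder h C \<longleftrightarrow> X 1 \<omega> \<in> ?B \<and> X (int h + 1) \<omega> \<in> ?B" for \<omega>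
      using scaled_block_coordinate[OF one(1)] scaled_block_coordinate[OF one(2)]
      by (simp add: end_cylinder_def add.commute)
    then show ?thesis
      using prob_pair_lag[OF vimage_ext_vec_borel[OF C] vimage_ext_vec_borel[OF C], of 1 "a n" "int h + 1" "a n"] by simp
  qed
  ultimately show ?thesis by (simp add: tau_def)
qed

end

section \<open>Sums over lags\<close>

lemma sum_lag_row: "(\<Sum>s = 1..n. c (Suc n - s)) = (\<Sum>h = 1..n. c h)"
  by (rule sum.reindex_bij_witness[of _ "\<lambda>h. Suc n - h" "\<lambda>s. Suc n - s"]) auto

text \<open>Enlarging the square of index pairs by one row and one column adds the diagonal term and every lag
  \<open>1, \<dots>, n\<close> twice.\<close>

lemma double_sum_by_lag:
  fixes c :: "nat \<Rightarrow> real"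
  shows "(\<Sum>s = 1..n. \<Sum>t = 1..n. c (nat \<bar>int s - int t\<bar>)) = real n * c 0 + 2 * (\<Sum>h = 1..n. real (n - h) * c h)"
proof (induction n)
  case (Suc n)
  let ?f = "\<lambda>s t. c (nat \<bar>int s - int t\<bar>)"
  have r1: "(\<Sum>s = 1..n. ?f s (Suc n)) = (\<Sum>h = 1..n. c h)"
    unfolding sum_lag_row[of c n, symmetric] by (rule sum.cong) (auto intro!: arg_cong[of _ _ c])
  have r2: "(\<Sum>t = 1..n. ?f (Suc n) t) = (\<Sum>h = 1..n. c h)"
    unfolding sum_lag_row[of c n, symmetric] by (rule sum.cong) (auto intro!: arg_cong[of _ _ c])
  have "(\<Sum>s = 1..Suc n. \<Sum>t = 1..Suc n. ?f s t)
      = (\<Sum>s = 1..n. \<Sum>t = 1..n. ?f s t) + (\<Sum>s = 1..n. ?f s (Suc n)) + (\<Sum>t = 1..n. ?f (Suc n) t) + c 0"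
    by (simp add: sum.distrib)
  also have "\<dots> = (\<Sum>s = 1..n. \<Sum>t = 1..n. ?f s t) + 2 * (\<Sum>h = 1..n. c h) + c 0"
    unfolding r1 r2 by simp
  also have "\<dots> = real (Suc n) * c 0 + 2 * ((\<Sum>h = 1..n. real (n - h) * c h) + (\<Sum>h = 1..n. c h))"
    unfolding Suc.IH by (simp add: algebra_simps)
  also have "(\<Sum>h = 1..n. real (n - h) * c h) + (\<Sum>h = 1..n. c h) = (\<Sum>h = 1..n. real (Suc n - h) * c h)"
    unfolding sum.distrib[symmetric] by (rule sum.cong) (auto simp: Suc_diff_le algebra_simps)
  also have "\<dots> = (\<Sum>h = 1..Suc n. real (Suc n - h) * c h)" by simp
  finally show ?case .
qed simp

lemma sum_Un_le_nonneg:
  fixes f :: "'b \<Rightarrow> real"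
  assumes "finite A" "finite B" "\<And>x. x \<in> A \<inter> B \<Longrightarrow> 0 \<le> f x"
  shows "sum f (A \<union> B) \<le> sum f A + sum f B"
  using sum.union_inter[OF assms(1,2), of f] sum_nonneg[of "A \<inter> B" f] assms(3) by auto

text \<open>Only finitely many lags can be treated by termwise convergence.  Condition \<open>tight\<close> bounds the lags up to
  \<open>r n\<close> for all large \<open>n\<close>, up to the contribution \<open>q n * r n\<close> of the centring, and \<open>far\<close> disposes of the
  others.  Passing to the limit in finite sums, \<open>tight\<close> also bounds the tails of \<open>\<Sum> \<tau>\<close>.\<close>

lemma lag_sum_tendsto:
  fixes b :: "nat \<Rightarrow> nat \<Rightarrow> real" and \<tau> :: "nat \<Rightarrow> real" and r :: "nat \<Rightarrow> nat"
  assumes nonneg: "\<And>n h. 0 \<le> b n h" "\<And>n. 0 \<le> q n"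
    and lim: "\<forall>h\<ge>1. (\<lambda>n. b n h) \<longlonglongrightarrow> \<tau> h"
    and r: "filterlim r at_top sequentially"
    and tight: "\<forall>\<epsilon>>0. \<exists>k. \<forall>\<^sub>F n in sequentially. (\<Sum>h = k..r n. b n h) < \<epsilon>"
    and q: "q \<longlonglongrightarrow> 0" and qr: "(\<lambda>n. q n * real (r n)) \<longlonglongrightarrow> 0"
    and far: "\<forall>\<^sub>F n in sequentially. (\<Sum>h = r n..n. \<bar>b n h - q n\<bar>) \<le> e n" and e: "e \<longlonglongrightarrow> 0"
  shows "summable (\<lambda>h. \<tau> (h + 1))"
    and "(\<lambda>n. \<Sum>h = 1..n. (1 - real h / real n) * (b n h - q n)) \<longlonglongrightarrow> (\<Sum>h. \<tau> (h + 1))"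
proof -
  have \<tau>0: "0 \<le> \<tau> h" if "h \<ge> 1" for h
    using lim[rule_format, OF that] nonneg(1) by (intro LIMSEQ_le_const) auto
  have tail: "\<exists>k\<ge>1. (\<forall>\<^sub>F n in sequentially. (\<Sum>h = k..r n. b n h) < \<epsilon>) \<and> (\<forall>N. (\<Sum>h = k..N. \<tau> h) \<le> \<epsilon>)"
    if \<epsilon>: "\<epsilon> > 0" for \<epsilon>
  proof -
    obtain k where k: "\<forall>\<^sub>F n in sequentially. (\<Sum>h = k..r n. b n h) < \<epsilon>" using tight[rule_format, OF \<epsilon>] by blast
    have k': "\<forall>\<^sub>F n in sequentially. (\<Sum>h = Suc k..r n. b n h) < \<epsilon>"
      using k
    proof eventually_elim
      case (elim n)
      have "(\<Sum>h = Suc k..r n. b n h) \<le> (\<Sum>h = k..r n. b n h)"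
        by (rule sum_mono2) (auto simp: nonneg)
      with elim show ?case by linarith
    qed
    have "(\<Sum>h = Suc k..N. \<tau> h) \<le> \<epsilon>" for N
    proof (rule tendsto_upperbound)
      show "(\<lambda>n. \<Sum>h = Suc k..N. b n h) \<longlonglongrightarrow> (\<Sum>h = Suc k..N. \<tau> h)"
        by (intro tendsto_sum lim[rule_format]) auto
      have "\<forall>\<^sub>F n in sequentially. N \<le> r n" using r by (simp add: filterlim_at_top)
      with k' show "\<forall>\<^sub>F n in sequentially. (\<Sum>h = Suc k..N. b n h) \<le> \<epsilon>"
      proof eventually_elim
        case (elim n)
        have "(\<Sum>h = Suc k..N. b n h) \<le> (\<Sum>h = Suc k..r n. b n h)"
          using elim(2) by (intro sum_mono2) (auto simp: nonneg)
        with elim(1) show ?case by linarith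
      qed
    qed simp
    with k' show ?thesis by (intro exI[of _ "Suc k"]) auto
  qed
  \<comment> \<open>Stated as an inequality because \<open>N\<close> may be smaller than \<open>k\<close>.\<close>
  have split: "(\<Sum>h = 1..N. \<tau> h) \<le> (\<Sum>h = 1..<k. \<tau> h) + (\<Sum>h = k..N. \<tau> h)" if "k \<ge> 1" for k N
  proof -
    have "(\<Sum>h = 1..N. \<tau> h) \<le> sum \<tau> ({1..<k} \<union> {k..N})"
      using \<tau>0 that by (intro sum_mono2) auto
    also have "\<dots> \<le> (\<Sum>h = 1..<k. \<tau> h) + (\<Sum>h = k..N. \<tau> h)"
      by (rule sum_Un_le_nonneg) auto
    finally show ?thesis .
  qed
  show sm: "summable (\<lambda>h. \<tau> (h + 1))"
  proof -
    obtain k where k: "k \<ge> 1" "\<And>N. (\<Sum>h = k..N. \<tau> h) \<le> 1" using tail[of 1] by auto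
    show ?thesis
    proof (rule bounded_imp_summable)
      fix N
      have "(\<Sum>h\<le>N. \<tau> (h + 1)) = (\<Sum>h = 1..Suc N. \<tau> h)"
        by (rule sum.reindex_bij_witness[of _ "\<lambda>h. h - 1" "\<lambda>h. h + 1"]) auto
      then show "(\<Sum>h\<le>N. \<tau> (h + 1)) \<le> (\<Sum>h = 1..<k. \<tau> h) + 1"
        using split[OF k(1), of "Suc N"] k(2)[of "Suc N"] by linarith
    qed (use \<tau>0 in auto)
  qed
  let ?L = "\<Sum>h. \<tau> (h + 1)"
  have rest: "\<bar>?L - (\<Sum>h = 1..<k. \<tau> h)\<bar> \<le> \<epsilon>" if k: "k \<ge> 1" "\<And>N. (\<Sum>h = k..N. \<tau> h) \<le> \<epsilon>" for k \<epsilon>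
  proof -
    \<comment> \<open>The series starts at index 0 and the lags at 1.\<close>
    have eq: "(\<Sum>h<N. \<tau> (h + 1)) = (\<Sum>h = 1..N. \<tau> h)" for N
      by (rule sum.reindex_bij_witness[of _ "\<lambda>h. h - 1" "\<lambda>h. h + 1"]) auto
    have "(\<Sum>h<N. \<tau> (h + 1)) \<le> (\<Sum>h = 1..<k. \<tau> h) + \<epsilon>" for N
      using split[OF k(1), of N] k(2)[of N] unfolding eq by linarith
    then have "?L \<le> (\<Sum>h = 1..<k. \<tau> h) + \<epsilon>" using sm by (intro suminf_le_const)
    moreover have "(\<Sum>h<k - 1. \<tau> (h + 1)) \<le> ?L" using sm \<tau>0 by (intro sum_le_suminf) auto
    moreover have "{1..k - 1} = {1..<k}" by auto
    ultimately show ?thesis unfolding eq using k(2)[of 0] k(1) by simp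
  qed
  show "(\<lambda>n. \<Sum>h = 1..n. (1 - real h / real n) * (b n h - q n)) \<longlonglongrightarrow> ?L"
  proof (rule LIMSEQ_I)
    fix \<epsilon> :: real assume "\<epsilon> > 0"
    \<comment> \<open>One fifth for each of: the first lags, the lags up to \<open>r n\<close>, their centring, the far lags, and the tail
      of the series.\<close>
    then have \<epsilon>: "\<epsilon> / 5 > 0" by simp
    obtain k where k: "k \<ge> 1" and near: "\<forall>\<^sub>F n in sequentially. (\<Sum>h = k..r n. b n h) < \<epsilon> / 5"
      and k\<tau>: "\<And>N. (\<Sum>h = k..N. \<tau> h) \<le> \<epsilon> / 5" using tail[OF \<epsilon>] by blast
    let ?w = "\<lambda>n h. (1 - real h / real n) * (b n h - q n)"
    have "(\<lambda>n. \<Sum>h = 1..<k. ?w n h) \<longlonglongrightarrow> (\<Sum>h = 1..<k. (1 - 0) * (\<tau> h - 0))"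
      by (intro tendsto_sum tendsto_mult tendsto_diff lim[rule_format] q tendsto_const lim_const_over_n) auto
    then have "\<forall>\<^sub>F n in sequentially. dist (\<Sum>h = 1..<k. ?w n h) (\<Sum>h = 1..<k. (1 - 0) * (\<tau> h - 0)) < \<epsilon> / 5"
      using \<epsilon> by (rule tendstoD)
    moreover have "\<forall>\<^sub>F n in sequentially. q n * real (r n) < \<epsilon> / 5" by (rule order_tendstoD(2)[OF qr \<epsilon>])
    moreover have "\<forall>\<^sub>F n in sequentially. e n < \<epsilon> / 5" by (rule order_tendstoD(2)[OF e \<epsilon>])
    ultimately have "\<forall>\<^sub>F n in sequentially. norm ((\<Sum>h = 1..n. ?w n h) - ?L) < \<epsilon>"
      using near far eventually_ge_at_top[of k]
    proof eventually_elim
      case (elim n)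
      have "{1..n} = {1..<k} \<union> {k..n}" using k elim(6) by auto
      then have "(\<Sum>h = 1..n. ?w n h) = (\<Sum>h = 1..<k. ?w n h) + (\<Sum>h = k..n. ?w n h)"
        by (simp only:) (rule sum.union_disjoint, auto)
      moreover have "\<bar>\<Sum>h = k..n. ?w n h\<bar> < 3 * (\<epsilon> / 5)"
      proof -
        have "\<bar>\<Sum>h = k..n. ?w n h\<bar> \<le> (\<Sum>h = k..n. \<bar>?w n h\<bar>)" by (rule sum_abs)
        also have "\<dots> \<le> (\<Sum>h = k..n. \<bar>b n h - q n\<bar>)"
        proof (rule sum_mono)
          fix h assume h: "h \<in> {k..n}"
          then have "0 \<le> 1 - real h / real n" "1 - real h / real n \<le> 1" using k by auto
          then show "\<bar>?w n h\<bar> \<le> \<bar>b n h - q n\<bar>" by (simp add: abs_mult mult_left_le_one_le)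
        qed
        also have "\<dots> \<le> (\<Sum>h \<in> {k..r n} \<union> {r n..n}. \<bar>b n h - q n\<bar>)"
          by (rule sum_mono2) auto
        also have "\<dots> \<le> (\<Sum>h = k..r n. \<bar>b n h - q n\<bar>) + (\<Sum>h = r n..n. \<bar>b n h - q n\<bar>)"
          by (rule sum_Un_le_nonneg) auto
        also have "(\<Sum>h = k..r n. \<bar>b n h - q n\<bar>) \<le> (\<Sum>h = k..r n. b n h + q n)"
          using nonneg by (intro sum_mono) (simp add: abs_le_iff)
        also have "\<dots> = (\<Sum>h = k..r n. b n h) + real (card {k..r n}) * q n" by (simp add: sum.distrib)
        also have "real (card {k..r n}) * q n \<le> real (r n) * q n"
          using k nonneg by (intro mult_right_mono) auto
        finally show ?thesis using elim(2-5) by (simp add: mult.commute)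
      qed
      moreover have "\<bar>?L - (\<Sum>h = 1..<k. \<tau> h)\<bar> \<le> \<epsilon> / 5" by (rule rest[OF k k\<tau>])
      moreover have "\<bar>(\<Sum>h = 1..<k. ?w n h) - (\<Sum>h = 1..<k. \<tau> h)\<bar> < \<epsilon> / 5"
        using elim(1) by (simp add: dist_real_def)
      ultimately show ?case unfolding real_norm_def by linarith
    qed
    then show "\<exists>no. \<forall>n\<ge>no. norm ((\<Sum>h = 1..n. ?w n h) - ?L) < \<epsilon>" by (simp add: eventually_sequentially)
  qed
qed

lemma (in prob_space) indicator_sum_moments:
  fixes c :: real
  assumes E: "\<And>t. t \<in> J \<Longrightarrow> E t \<in> events" and J: "finite J"
  defines "Y \<equiv> \<lambda>\<omega>. c * (\<Sum>t\<in>J. indicator (E t) \<omega>)"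
  shows "expectation Y = c * (\<Sum>t\<in>J. prob (E t))"
    and "variance Y = c\<^sup>2 * (\<Sum>s\<in>J. \<Sum>t\<in>J. prob (E s \<inter> E t) - prob (E s) * prob (E t))"
    and "random_variable borel Y" and "integrable M (\<lambda>\<omega>. (Y \<omega>)\<^sup>2)"
proof -
  have int: "integrable M (indicator A :: _ \<Rightarrow> real)" if "A \<in> events" for A
    using that by (simp add: integrable_indicator_iff less_top emeasure_eq_measure)
  have iY: "integrable M Y" unfolding Y_def using int E by auto
  show eY: "expectation Y = c * (\<Sum>t\<in>J. prob (E t))"
    unfolding Y_def using int E by (subst integral_mult_right_zero) (simp add: Bochner_Integration.integral_sum)
  have sq: "(Y \<omega>)\<^sup>2 = c\<^sup>2 * (\<Sum>s\<in>J. \<Sum>t\<in>J. indicator (E s \<inter> E t) \<omega>)" for \<omega>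
    by (simp add: Y_def power_mult_distrib power2_eq_square[of "sum _ _"] sum_product indicator_inter_arith)
  have EE: "E s \<inter> E t \<in> events" if "s \<in> J" "t \<in> J" for s t using E that by auto
  show i2: "integrable M (\<lambda>\<omega>. (Y \<omega>)\<^sup>2)"
    unfolding sq using int EE by (intro integrable_mult_right integrable_sum) auto
  have "expectation (\<lambda>\<omega>. (Y \<omega>)\<^sup>2) = c\<^sup>2 * expectation (\<lambda>\<omega>. \<Sum>s\<in>J. \<Sum>t\<in>J. indicator (E s \<inter> E t) \<omega>)"
    unfolding sq by simp
  also have "expectation (\<lambda>\<omega>. \<Sum>s\<in>J. \<Sum>t\<in>J. indicator (E s \<inter> E t) \<omega>) = (\<Sum>s\<in>J. \<Sum>t\<in>J. prob (E s \<inter> E t))"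
    using int EE by (simp add: Bochner_Integration.integral_sum integrable_sum)
  finally have "expectation (\<lambda>\<omega>. (Y \<omega>)\<^sup>2) = c\<^sup>2 * (\<Sum>s\<in>J. \<Sum>t\<in>J. prob (E s \<inter> E t))" .
  moreover have "(expectation Y)\<^sup>2 = c\<^sup>2 * (\<Sum>s\<in>J. \<Sum>t\<in>J. prob (E s) * prob (E t))"
    unfolding eY by (simp add: power_mult_distrib power2_eq_square[of "sum _ _"] sum_product)
  ultimately show "variance Y = c\<^sup>2 * (\<Sum>s\<in>J. \<Sum>t\<in>J. prob (E s \<inter> E t) - prob (E s) * prob (E t))"
    unfolding variance_eq[OF iY i2] by (simp add: sum_subtractf right_diff_distrib)
  show "random_variable borel Y" using iY by simp
qed

section \<open>Mixing, moments and convergence in probability\<close>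

lemma mixing_coeff_bound:
  assumes "prob_space M" "A \<in> generated_events M X {..0}" "B \<in> generated_events M X {int h..}"
  shows "\<bar>measure M (A \<inter> B) - measure M A * measure M B\<bar> \<le> mixing_coeff M X h"
proof -
  interpret prob_space M by fact
  let ?f = "\<lambda>(A, B). \<bar>prob (A \<inter> B) - prob A * prob B\<bar>"
  have "?f p \<le> 1" for p
  proof -
    obtain A B where p: "p = (A, B)" by fastforce
    have "prob A * prob B \<le> 1" "0 \<le> prob A * prob B" by (auto intro: mult_le_one)
    then show ?thesis
      using prob_le_1[of "A \<inter> B"] measure_nonneg[of M "A \<inter> B"] unfolding p prod.case by linarith
  qed
  then have "bdd_above (?f ` (generated_events M X {..0} \<times> generated_events M X {int h..}))"
    by (intro bdd_aboveI[of _ 1]) blast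
  from cSUP_upper[OF _ this, of "(A, B)"] show ?thesis
    using assms(2,3) by (simp add: mixing_coeff_def)
qed

lemma generated_events_vimage:
  "s \<in> S \<Longrightarrow> B \<in> sets borel \<Longrightarrow> {\<omega> \<in> space M. X s \<omega> \<in> B} \<in> generated_events M X S"
  unfolding generated_events_def
  by (rule sigma_sets.Basic) (auto simp: vimage_def Int_def conj_commute intro!: exI[of _ B])

context stationary_sequence
begin

lemma mixing_pair_bound:
  assumes B: "B \<in> sets borel"
  shows "\<bar>prob {\<omega> \<in> space M. X 0 \<omega> \<in> B \<and> X (int h) \<omega> \<in> B} - (prob {\<omega> \<in> space M. X 0 \<omega> \<in> B})\<^sup>2\<bar> \<le> mixing_coeff M X h"
proof -
  have "{\<omega> \<in> space M. X 0 \<omega> \<in> B} \<inter> {\<omega> \<in> space M. X (int h) \<omega> \<in> B}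
      = {\<omega> \<in> space M. X 0 \<omega> \<in> B \<and> X (int h) \<omega> \<in> B}" by auto
  then show ?thesis
    using mixing_coeff_bound[OF prob_space_axioms generated_events_vimage[of 0 "{..0}" B M X]
        generated_events_vimage[of "int h" "{int h..}" B M X]] B prob_shift[OF B, of "int h"]
    by (simp add: power2_eq_square)
qed

text \<open>By stationarity the covariance of two indicators depends on the lag only, so the double sum over times
  collapses to a single sum over lags.\<close>

lemma exceedance_moments:
  fixes c :: real and B :: "(real ^ 'd) set" and n :: nat
  assumes B: "B \<in> sets borel"
  defines "Y \<equiv> \<lambda>\<omega>. c * (\<Sum>t = 1..n. indicator B (X (int t) \<omega>))"
    and "p \<equiv> prob {\<omega> \<in> space M. X 0 \<omega> \<in> B}"
    and "p2 \<equiv> \<lambda>h. prob {\<omega> \<in> space M. X 0 \<omega> \<in> B \<and> X (int h) \<omega> \<in> B}"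
  shows "expectation Y = c * (real n * p)"
    and "variance Y = c\<^sup>2 * (real n * (p - p\<^sup>2) + 2 * (\<Sum>h = 1..n. real (n - h) * (p2 h - p\<^sup>2)))"
    and "random_variable borel Y" and "integrable M (\<lambda>\<omega>. (Y \<omega>)\<^sup>2)"
proof -
  define E where "E t = {\<omega> \<in> space M. X (int t) \<omega> \<in> B}" for t :: nat
  define Z where "Z \<omega> = c * (\<Sum>t\<in>{1..n}. indicator (E t) \<omega>)" for \<omega>
  have ev: "E t \<in> events" for t unfolding E_def by (rule X_event[OF B])
  have YZ: "Y \<omega> = Z \<omega>" if "\<omega> \<in> space M" for \<omega>
    using that by (simp add: Y_def Z_def E_def indicator_def)
  note mom = indicator_sum_moments[of "{1..n}" E c, OF ev finite_atLeastAtMost, folded Z_def]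
  have EYZ: "expectation Y = expectation Z" by (rule Bochner_Integration.integral_cong) (auto simp: YZ)
  have pE: "prob (E t) = p" for t unfolding E_def p_def by (rule prob_shift[OF B])
  have pEE: "prob (E s \<inter> E t) = p2 (nat \<bar>int s - int t\<bar>)" for s t
  proof -
    have *: "prob (E s \<inter> E t) = p2 (nat \<bar>int s - int t\<bar>)" if "s \<le> t" for s t
    proof -
      have "E s \<inter> E t = {\<omega> \<in> space M. X (int s) \<omega> \<in> B \<and> X (int t) \<omega> \<in> B}" by (auto simp: E_def)
      then show ?thesis using that prob_pair_lag[OF B B, of "int s" "int t"] by (simp add: p2_def)
    qed
    show ?thesis using *[of s t] *[of t s] by (cases "s \<le> t") (auto simp: Int_commute abs_minus_commute)
  qed
  show "expectation Y = c * (real n * p)" unfolding EYZ mom(1) pE by simp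
  have "variance Y = variance Z" unfolding EYZ by (rule Bochner_Integration.integral_cong) (auto simp: YZ)
  also have "\<dots> = c\<^sup>2 * (\<Sum>s = 1..n. \<Sum>t = 1..n. p2 (nat \<bar>int s - int t\<bar>) - p\<^sup>2)"
    unfolding mom(2) pE pEE by (simp add: power2_eq_square)
  also have "\<dots> = c\<^sup>2 * (real n * (p2 0 - p\<^sup>2) + 2 * (\<Sum>h = 1..n. real (n - h) * (p2 h - p\<^sup>2)))"
    using double_sum_by_lag[of "\<lambda>h. p2 h - p\<^sup>2" n] by simp
  also have "p2 0 = p" by (simp add: p2_def p_def)
  finally show "variance Y = c\<^sup>2 * (real n * (p - p\<^sup>2) + 2 * (\<Sum>h = 1..n. real (n - h) * (p2 h - p\<^sup>2)))" .
  show "random_variable borel Y" using mom(3) by (subst measurable_cong[OF YZ])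
  show "integrable M (\<lambda>\<omega>. (Y \<omega>)\<^sup>2)"
    using mom(4) by (subst Bochner_Integration.integrable_cong[OF refl, of _ _ "\<lambda>\<omega>. (Z \<omega>)\<^sup>2"]) (simp_all add: YZ)
qed

end

lemma (in prob_space) tendsto_in_prob_of_moments:
  fixes Y :: "nat \<Rightarrow> 'a \<Rightarrow> real"
  assumes Y: "\<And>n. random_variable borel (Y n)" "\<And>n. integrable M (\<lambda>\<omega>. (Y n \<omega>)\<^sup>2)"
    and e: "(\<lambda>n. expectation (Y n)) \<longlonglongrightarrow> l" and v: "(\<lambda>n. variance (Y n)) \<longlonglongrightarrow> 0" and \<epsilon>: "\<epsilon> > 0"
  shows "(\<lambda>n. prob {\<omega> \<in> space M. \<bar>Y n \<omega> - l\<bar> > \<epsilon>}) \<longlonglongrightarrow> 0"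
proof (rule tendsto_sandwich[where f="\<lambda>_. 0"])
  have \<epsilon>2: "\<epsilon> / 2 > 0" using \<epsilon> by simp
  show "(\<lambda>n. variance (Y n) / (\<epsilon> / 2)\<^sup>2) \<longlonglongrightarrow> 0"
    using tendsto_divide[OF v tendsto_const[of "(\<epsilon> / 2)\<^sup>2"]] \<epsilon> by simp
  have "\<forall>\<^sub>F n in sequentially. dist (expectation (Y n)) l < \<epsilon> / 2" by (rule tendstoD[OF e \<epsilon>2])
  then show "\<forall>\<^sub>F n in sequentially. prob {\<omega> \<in> space M. \<bar>Y n \<omega> - l\<bar> > \<epsilon>} \<le> variance (Y n) / (\<epsilon> / 2)\<^sup>2"
  proof eventually_elim
    case (elim n)
    have [measurable]: "random_variable borel (Y n)" by (rule Y(1))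
    have "prob {\<omega> \<in> space M. \<bar>Y n \<omega> - l\<bar> > \<epsilon>} \<le> prob {\<omega> \<in> space M. \<epsilon> / 2 \<le> \<bar>Y n \<omega> - expectation (Y n)\<bar>}"
    proof (rule finite_measure_mono)
      show "{\<omega> \<in> space M. \<bar>Y n \<omega> - l\<bar> > \<epsilon>} \<subseteq> {\<omega> \<in> space M. \<epsilon> / 2 \<le> \<bar>Y n \<omega> - expectation (Y n)\<bar>}"
      proof (intro subsetI CollectI conjI)
        fix \<omega> assume "\<omega> \<in> {\<omega> \<in> space M. \<bar>Y n \<omega> - l\<bar> > \<epsilon>}"
        then have *: "\<omega> \<in> space M" "\<bar>Y n \<omega> - l\<bar> > \<epsilon>" by auto
        then show "\<omega> \<in> space M" by simp
        have "\<bar>expectation (Y n) - l\<bar> < \<epsilon> / 2" using elim by (simp only: dist_real_def)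
        then show "\<epsilon> / 2 \<le> \<bar>Y n \<omega> - expectation (Y n)\<bar>" using *(2) by linarith
      qed
    qed measurable
    also have "\<dots> \<le> variance (Y n) / (\<epsilon> / 2)\<^sup>2" by (rule Chebyshev_inequality[OF Y(1,2) \<epsilon>2])
    finally show ?case .
  qed
qed auto

section \<open>Asymptotics of the tail estimator\<close>

context regularly_varying_sequence
begin

text \<open>The variance is divided by \<open>m / n\<close> so that one limit serves both for the equivalence, when it is positive,
  and for the little-o bound, when \<open>\<mu>(C)\<close> and with it every \<open>\<tau>\<^sub>h\<close> is 0.\<close>

lemma tail_estimator_asymptotics:
  fixes C :: "'d evec set" and m r :: "nat \<Rightarrow> nat"
  assumes C: "C \<in> sets borel" and bd: "bounded_away_from_zero C"
    and fr: "emeasure (tail_measure M X a) (frontier C) = 0"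
    and frh: "\<forall>h\<ge>1. emeasure (tail_limit M X a (h + 1)) (punctured_space (h + 1) frontier_of end_cylinder h C) = 0"
    and m: "filterlim m at_top sequentially" and r: "filterlim r at_top sequentially"
    and mn: "(\<lambda>n. real (m n) / real n) \<longlonglongrightarrow> 0"
    and rm: "(\<lambda>n. real (r n) / real (m n)) \<longlonglongrightarrow> 0"
    and mix: "(\<lambda>n. of_nat (m n) * (\<Sum>h. ennreal (mixing_coeff M X (r n + h)))) \<longlonglongrightarrow> 0"
    and clus: "\<forall>\<epsilon>>0. (\<lambda>k. limsup (\<lambda>n. ereal (real (m n) *
              (\<Sum>h = k..r n. measure M {\<omega> \<in> space M.
                 norm (X (int h) \<omega>) > \<epsilon> * a (m n) \<and> norm (X 0 \<omega>) > \<epsilon> * a (m n)})))) \<longlonglongrightarrow> 0"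
  defines "\<mu>C \<equiv> measure (tail_measure M X a) C" and "\<tau> \<equiv> tau M X a C"
  shows "(\<lambda>n. expectation (P_hat X a m C n)) \<longlonglongrightarrow> \<mu>C"
    and "summable (\<lambda>h. \<tau> (h + 1))"
    and "(\<lambda>n. variance (P_hat X a m C n) / (real (m n) / real n)) \<longlonglongrightarrow> \<mu>C + 2 * (\<Sum>h. \<tau> (h + 1))"
    and "\<mu>C = 0 \<longrightarrow> (\<Sum>h. \<tau> (h + 1)) = 0"
    and "0 \<le> (\<Sum>h. \<tau> (h + 1))"
    and "\<And>n. random_variable borel (P_hat X a m C n)" and "\<And>n. integrable M (\<lambda>\<omega>. (P_hat X a m C n \<omega>)\<^sup>2)"
proof -
  define B where "B n = {v :: real ^ 'd. ext_vec (v /\<^sub>R a (m n)) \<in> C}" for n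
  have B: "B n \<in> sets borel" for n unfolding B_def by (rule vimage_ext_vec_borel[OF C])
  define p where "p n = prob {\<omega> \<in> space M. X 0 \<omega> \<in> B n}" for n
  define p2 where "p2 n h = prob {\<omega> \<in> space M. X 0 \<omega> \<in> B n \<and> X (int h) \<omega> \<in> B n}" for n h
  have P_hat: "P_hat X a m C n = (\<lambda>\<omega>. real (m n) / real n * (\<Sum>t = 1..n. indicator (B n) (X (int t) \<omega>)))" for n
    by (simp add: fun_eq_iff P_hat_def B_def indicator_def)
  have mom: "expectation (P_hat X a m C n) = real (m n) / real n * (real n * p n)"
    "variance (P_hat X a m C n) = (real (m n) / real n)\<^sup>2 *
       (real n * (p n - (p n)\<^sup>2) + 2 * (\<Sum>h = 1..n. real (n - h) * (p2 n h - (p n)\<^sup>2)))"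
    "random_variable borel (P_hat X a m C n)" "integrable M (\<lambda>\<omega>. (P_hat X a m C n \<omega>)\<^sup>2)" for n
    unfolding P_hat p_def p2_def by (rule exceedance_moments[OF B[of n]])+
  show "random_variable borel (P_hat X a m C n)" "integrable M (\<lambda>\<omega>. (P_hat X a m C n \<omega>)\<^sup>2)" for n
    using mom(3,4) by auto
  have mpos: "\<forall>\<^sub>F n in sequentially. m n > 0" using filterlim_at_top[THEN iffD1, OF m, rule_format, of 1] by eventually_elim simp
  have mp: "(\<lambda>n. real (m n) * p n) \<longlonglongrightarrow> \<mu>C"
    using filterlim_compose[OF tail_measure_tendsto[OF C bd fr] m] by (simp add: p_def B_def \<mu>C_def)
  have mp2: "(\<lambda>n. real (m n) * p2 n h) \<longlonglongrightarrow> \<tau> h" if "h \<ge> 1" for h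
    using filterlim_compose[OF tau_tendsto[OF C bd that frh[rule_format, OF that]] m] by (simp add: p2_def B_def \<tau>_def)
  have p2_le: "p2 n h \<le> p n" for n h
    unfolding p2_def p_def by (rule finite_measure_mono) (auto intro: X_event[OF B])
  show eP: "(\<lambda>n. expectation (P_hat X a m C n)) \<longlonglongrightarrow> \<mu>C"
    using mp
  proof (rule Lim_transform_eventually)
    show "\<forall>\<^sub>F n in sequentially. real (m n) * p n = expectation (P_hat X a m C n)"
      using eventually_gt_at_top[of 0] by eventually_elim (simp add: mom(1))
  qed
  have inv_m: "(\<lambda>n. 1 / real (m n)) \<longlonglongrightarrow> 0"
    using filterlim_compose[OF lim_1_over_n m] by simp
  have p0: "p \<longlonglongrightarrow> 0"
  proof (rule Lim_transform_eventually)
    show "(\<lambda>n. real (m n) * p n * (1 / real (m n))) \<longlonglongrightarrow> 0"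
      using tendsto_mult[OF mp inv_m] by simp
    show "\<forall>\<^sub>F n in sequentially. real (m n) * p n * (1 / real (m n)) = p n"
      using mpos by eventually_elim simp
  qed
  \<comment> \<open>The centring of each lag; it is of smaller order because \<open>m p\<close> converges.\<close>
  define q where "q n = real (m n) * (p n)\<^sup>2" for n
  have q0: "q \<longlonglongrightarrow> 0"
    using tendsto_mult[OF mp p0] by (simp add: q_def[abs_def] power2_eq_square mult.assoc)
  have qr: "(\<lambda>n. q n * real (r n)) \<longlonglongrightarrow> 0"
  proof (rule Lim_transform_eventually)
    show "(\<lambda>n. (real (m n) * p n) * (real (m n) * p n) * (real (r n) / real (m n))) \<longlonglongrightarrow> 0"
      using tendsto_mult[OF tendsto_mult[OF mp mp] rm] by simp
    show "\<forall>\<^sub>F n in sequentially. (real (m n) * p n) * (real (m n) * p n) * (real (r n) / real (m n)) = q n * real (r n)"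
      using mpos by eventually_elim (simp add: q_def power2_eq_square)
  qed
  define b where "b n h = real (m n) * p2 n h" for n h
  have tight: "\<forall>\<epsilon>>0. \<exists>k. \<forall>\<^sub>F n in sequentially. (\<Sum>h = k..r n. b n h) < \<epsilon>"
  proof (intro allI impI)
    fix \<epsilon> :: real assume \<epsilon>: "\<epsilon> > 0"
    obtain s where s: "s > 0" "\<And>x. x \<in> C \<Longrightarrow> ereal s < ext_norm x"
      using bd by (auto simp: bounded_away_from_zero_def)
    let ?D = "\<lambda>n h. prob {\<omega> \<in> space M. norm (X (int h) \<omega>) > s * a (m n) \<and> norm (X 0 \<omega>) > s * a (m n)}"
    have "\<forall>\<^sub>F k in sequentially. limsup (\<lambda>n. ereal (real (m n) * (\<Sum>h = k..r n. ?D n h))) < ereal \<epsilon>"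
      using \<epsilon> by (intro order_tendstoD(2)[OF clus[rule_format, OF s(1)]]) simp
    then obtain k where "limsup (\<lambda>n. ereal (real (m n) * (\<Sum>h = k..r n. ?D n h))) < ereal \<epsilon>"
      by (auto simp: eventually_sequentially)
    then have "\<forall>\<^sub>F n in sequentially. ereal (real (m n) * (\<Sum>h = k..r n. ?D n h)) < ereal \<epsilon>"
      by (rule Limsup_lessD)
    moreover have "\<forall>\<^sub>F n in sequentially. a (m n) > 0"
      using filterlim_compose[OF a_at_top m] by (auto simp: filterlim_at_top_dense)
    ultimately have "\<forall>\<^sub>F n in sequentially. (\<Sum>h = k..r n. b n h) < \<epsilon>"
    proof eventually_elim
      case (elim n)
      \<comment> \<open>Points of the rescaled set are far out, so joint visits to it are joint exceedances of the norm.\<close>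
      have far: "norm v > s * a (m n)" if "v \<in> B n" for v
        using s(2)[of "ext_vec (v /\<^sub>R a (m n))"] that elim(2) 
        by (simp add: B_def ext_norm_ext_vec divide_inverse_commute[symmetric] less_divide_eq)
      have "p2 n h \<le> ?D n h" for h
        unfolding p2_def
      proof (rule finite_measure_mono)
        note [measurable] = X_measurable
        show "{\<omega> \<in> space M. norm (X (int h) \<omega>) > s * a (m n) \<and> norm (X 0 \<omega>) > s * a (m n)} \<in> events"
          by measurable
      qed (use far in auto)
      then have "(\<Sum>h = k..r n. b n h) \<le> real (m n) * (\<Sum>h = k..r n. ?D n h)"
        unfolding b_def sum_distrib_left[symmetric] by (intro mult_left_mono sum_mono) auto
      then show ?case using elim(1) by simp
    qed
    then show "\<exists>k. \<forall>\<^sub>F n in sequentially. (\<Sum>h = k..r n. b n h) < \<epsilon>" by blast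
  qed
  define e where "e n = enn2real (of_nat (m n) * (\<Sum>h. ennreal (mixing_coeff M X (r n + h))))" for n
  have e0: "e \<longlonglongrightarrow> 0" unfolding e_def[abs_def] using mix by (intro tendsto_enn2real) auto
  have mc0: "0 \<le> mixing_coeff M X h" for h
    using order_trans[OF abs_ge_zero mixing_pair_bound[of UNIV h]] by simp
  have far: "\<forall>\<^sub>F n in sequentially. (\<Sum>h = r n..n. \<bar>b n h - q n\<bar>) \<le> e n"
  proof -
    have "\<forall>\<^sub>F n in sequentially. of_nat (m n) * (\<Sum>h. ennreal (mixing_coeff M X (r n + h))) < 1"
      by (rule order_tendstoD(2)[OF mix]) simp
    then show ?thesis
    proof eventually_elim
      case (elim n)
      have "(\<Sum>h = r n..n. \<bar>b n h - q n\<bar>) = real (m n) * (\<Sum>h = r n..n. \<bar>p2 n h - (p n)\<^sup>2\<bar>)"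
        by (simp add: b_def q_def sum_distrib_left abs_mult right_diff_distrib[symmetric])
      also have "\<dots> \<le> real (m n) * (\<Sum>h = r n..n. mixing_coeff M X h)"
        unfolding p2_def p_def by (intro mult_left_mono sum_mono mixing_pair_bound[OF B]) simp
      also have "\<dots> \<le> real (m n) * (\<Sum>h<Suc n. mixing_coeff M X (r n + h))"
      proof (intro mult_left_mono)
        have "(\<Sum>h = r n..n. mixing_coeff M X h) = (\<Sum>h<Suc n - r n. mixing_coeff M X (r n + h))"
          by (rule sum.reindex_bij_witness[of _ "\<lambda>h. r n + h" "\<lambda>h. h - r n"]) auto
        also have "\<dots> \<le> (\<Sum>h<Suc n. mixing_coeff M X (r n + h))"
          by (rule sum_mono2) (auto simp: mc0)
        finally show "(\<Sum>h = r n..n. mixing_coeff M X h) \<le> (\<Sum>h<Suc n. mixing_coeff M X (r n + h))" .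
      qed simp
      also have "\<dots> = enn2real (ennreal (real (m n) * (\<Sum>h<Suc n. mixing_coeff M X (r n + h))))"
        by (rule enn2real_ennreal[symmetric]) (intro mult_nonneg_nonneg sum_nonneg mc0, simp)
      also have "\<dots> \<le> e n"
        unfolding e_def
      proof (rule enn2real_mono)
        have "ennreal (real (m n) * (\<Sum>h<Suc n. mixing_coeff M X (r n + h)))
            = of_nat (m n) * (\<Sum>h<Suc n. ennreal (mixing_coeff M X (r n + h)))"
          by (simp only: ennreal_mult'[OF of_nat_0_le_iff] sum_ennreal[OF mc0] ennreal_of_nat_eq_real_of_nat)
        also have "\<dots> \<le> of_nat (m n) * (\<Sum>h. ennreal (mixing_coeff M X (r n + h)))"
          by (intro mult_left_mono sum_le_suminf) auto
        finally show "ennreal (real (m n) * (\<Sum>h<Suc n. mixing_coeff M X (r n + h)))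
            \<le> of_nat (m n) * (\<Sum>h. ennreal (mixing_coeff M X (r n + h)))" .
        show "of_nat (m n) * (\<Sum>h. ennreal (mixing_coeff M X (r n + h))) < \<top>"
          by (rule less_trans[OF elim]) simp
      qed
      finally show ?case .
    qed
  qed
  have b0: "0 \<le> b n h" "0 \<le> q n" for n h by (auto simp: b_def q_def p2_def)
  have blim: "\<forall>h\<ge>1. (\<lambda>n. b n h) \<longlonglongrightarrow> \<tau> h" using mp2 by (simp add: b_def)
  note lag = lag_sum_tendsto[of b q \<tau> r e, OF b0 blim r tight q0 qr far e0]
  show sm: "summable (\<lambda>h. \<tau> (h + 1))" by (rule lag(1))
  have \<tau>_bounds: "0 \<le> \<tau> h" "\<tau> h \<le> \<mu>C" if "h \<ge> 1" for h
  proof -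
    show "0 \<le> \<tau> h" by (rule LIMSEQ_le_const[OF mp2[OF that]]) (use b0 in \<open>auto simp: b_def\<close>)
    show "\<tau> h \<le> \<mu>C" by (rule LIMSEQ_le[OF mp2[OF that] mp]) (auto intro!: mult_left_mono p2_le)
  qed
  show "0 \<le> (\<Sum>h. \<tau> (h + 1))" using \<tau>_bounds(1) by (intro suminf_nonneg sm) auto
  show "\<mu>C = 0 \<longrightarrow> (\<Sum>h. \<tau> (h + 1)) = 0"
  proof
    assume that: "\<mu>C = 0"
    have "\<tau> (h + 1) = 0" for h using \<tau>_bounds[of "h + 1"] that by simp
    then show "(\<Sum>h. \<tau> (h + 1)) = 0" by simp
  qed
  show "(\<lambda>n. variance (P_hat X a m C n) / (real (m n) / real n)) \<longlonglongrightarrow> \<mu>C + 2 * (\<Sum>h. \<tau> (h + 1))"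
  proof (rule Lim_transform_eventually)
    show "(\<lambda>n. (real (m n) * p n - q n) + 2 * (\<Sum>h = 1..n. (1 - real h / real n) * (b n h - q n)))
        \<longlonglongrightarrow> \<mu>C + 2 * (\<Sum>h. \<tau> (h + 1))"
      using tendsto_add[OF tendsto_diff[OF mp q0] tendsto_mult[OF tendsto_const[of 2] lag(2)]] by simp
    show "\<forall>\<^sub>F n in sequentially. (real (m n) * p n - q n) + 2 * (\<Sum>h = 1..n. (1 - real h / real n) * (b n h - q n))
        = variance (P_hat X a m C n) / (real (m n) / real n)"
      using mpos eventually_gt_at_top[of 0]
    proof eventually_elim
      case (elim n)
      have "(1 - real h / real n) * (b n h - q n) = real (m n) / real n * (real (n - h) * (p2 n h - (p n)\<^sup>2))"
        if "h \<in> {1..n}" for h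
        using that elim by (simp add: b_def q_def field_simps of_nat_diff)
      then have S: "(\<Sum>h = 1..n. (1 - real h / real n) * (b n h - q n))
          = real (m n) / real n * (\<Sum>h = 1..n. real (n - h) * (p2 n h - (p n)\<^sup>2))"
        unfolding sum_distrib_left by (intro sum.cong) auto
      have D: "real (m n) * p n - q n = real (m n) / real n * (real n * (p n - (p n)\<^sup>2))"
        using elim by (simp add: q_def algebra_simps)
      show ?case
        unfolding mom(2) S D using elim by (simp add: power2_eq_square field_simps)
    qed
  qed
qed

end

theorem theorem3p1:
  fixes M :: "'a measure"
    and X :: "int \<Rightarrow> 'a \<Rightarrow> real ^ ('d::finite)"
    and \<alpha> :: real
    and a :: "nat \<Rightarrow> real"
    and C :: "'d evec set"
    and m r :: "nat \<Rightarrow> nat"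
  assumes "prob_space M"
    and "\<And>t. X t \<in> borel_measurable M"
    and "strictly_stationary M X"
    and "regularly_varying M X \<alpha>"
    and "incseq a"
    and "filterlim a at_top sequentially"
    and "(\<lambda>n. measure M {\<omega> \<in> space M. norm (X 0 \<omega>) > a n}) \<sim>[sequentially] (\<lambda>n. 1 / real n)"
    and "C \<in> sets borel"
    and "bounded_away_from_zero C"
    and "emeasure (tail_measure M X a) (frontier C) = 0"
    and "\<And>h. h \<ge> 1 \<Longrightarrow>
           emeasure (tail_limit M X a (h + 1))
             (punctured_space (h + 1) frontier_of end_cylinder h C) = 0"
    and "alpha_mixing M X"
    and "filterlim m at_top sequentially"
    and "filterlim r at_top sequentially"
    and "(\<lambda>n. real (m n) / real n) \<longlonglongrightarrow> 0"
    and "(\<lambda>n. real (r n) / real (m n)) \<longlonglongrightarrow> 0"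
    and "(\<lambda>n. of_nat (m n) * (\<Sum>h. ennreal (mixing_coeff M X (r n + h)))) \<longlonglongrightarrow> 0"
    and "\<And>\<epsilon>. \<epsilon> > 0 \<Longrightarrow>
           (\<lambda>k. limsup (\<lambda>n. ereal (real (m n) *
              (\<Sum>h = k..r n. measure M {\<omega> \<in> space M.
                 norm (X (int h) \<omega>) > \<epsilon> * a (m n) \<and> norm (X 0 \<omega>) > \<epsilon> * a (m n)})))) \<longlonglongrightarrow> 0"
  shows "(\<lambda>n. prob_space.expectation M (P_hat X a m C n)) \<longlonglongrightarrow> measure (tail_measure M X a) C
    \<and> summable (\<lambda>h. tau M X a C (h + 1))
    \<and> (if measure (tail_measure M X a) C = 0
       then (\<lambda>n. prob_space.variance M (P_hat X a m C n)) \<in> o(\<lambda>n. real (m n) / real n)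
       else (\<lambda>n. prob_space.variance M (P_hat X a m C n)) \<sim>[sequentially]
              (\<lambda>n. real (m n) / real n *
                 (measure (tail_measure M X a) C + 2 * (\<Sum>h. tau M X a C (h + 1)))))
    \<and> (\<forall>\<epsilon>>0. (\<lambda>n. measure M {\<omega> \<in> space M.
                 \<bar>P_hat X a m C n \<omega> - measure (tail_measure M X a) C\<bar> > \<epsilon>}) \<longlonglongrightarrow> 0)"
proof -
  interpret stationary_sequence M X
    using assms(1-3) by (intro stationary_sequence.intro stationary_sequence_axioms.intro)
  interpret regularly_varying_sequence M X \<alpha> a
    using assms(4,6,7) by unfold_locales
  let ?\<mu> = "measure (tail_measure M X a) C"
  let ?S = "\<Sum>h. tau M X a C (h + 1)"
  let ?c = "\<lambda>n. real (m n) / real n"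
  let ?V = "\<lambda>n. variance (P_hat X a m C n)"
  have fr: "\<forall>h\<ge>1. emeasure (tail_limit M X a (h + 1)) (punctured_space (h + 1) frontier_of end_cylinder h C) = 0"
    using assms(11) by blast
  have clus: "\<forall>\<epsilon>>0. (\<lambda>k. limsup (\<lambda>n. ereal (real (m n) * (\<Sum>h = k..r n. prob {\<omega> \<in> space M.
      norm (X (int h) \<omega>) > \<epsilon> * a (m n) \<and> norm (X 0 \<omega>) > \<epsilon> * a (m n)})))) \<longlonglongrightarrow> 0"
    using assms(18) by blast
  note est = tail_estimator_asymptotics[OF assms(8-10) fr assms(13-17) clus]
  have nz: "\<forall>\<^sub>F n in sequentially. ?c n \<noteq> 0"
    using filterlim_at_top[THEN iffD1, OF assms(13), rule_format, of 1] eventually_gt_at_top[of 0]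
    by eventually_elim simp
  have var: "if ?\<mu> = 0 then ?V \<in> o(?c) else ?V \<sim>[sequentially] (\<lambda>n. ?c n * (?\<mu> + 2 * ?S))"
  proof (cases "?\<mu> = 0")
    case True
    have "(\<lambda>n. ?V n / ?c n) \<longlonglongrightarrow> 0" using est(3,4) True by simp
    then have "?V \<in> o(?c)" using nz by (rule smalloI_tendsto)
    with True show ?thesis by simp
  next
    case False
    then have "?\<mu> + 2 * ?S > 0" using est(5) measure_nonneg[of "tail_measure M X a" C] by linarith
    then have "?V \<sim>[sequentially] (\<lambda>n. (?\<mu> + 2 * ?S) * ?c n)"
      using est(3) by (intro asymp_equivI'_const) auto
    with False show ?thesis by (simp add: mult.commute)
  qed
  have V0: "?V \<longlonglongrightarrow> 0"
  proof (rule Lim_transform_eventually)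
    show "(\<lambda>n. ?V n / ?c n * ?c n) \<longlonglongrightarrow> 0" using tendsto_mult[OF est(3) assms(15)] by simp
    show "\<forall>\<^sub>F n in sequentially. ?V n / ?c n * ?c n = ?V n" using nz by eventually_elim simp
  qed
  have "\<forall>\<epsilon>>0. (\<lambda>n. prob {\<omega> \<in> space M. \<bar>P_hat X a m C n \<omega> - ?\<mu>\<bar> > \<epsilon>}) \<longlonglongrightarrow> 0"
    using tendsto_in_prob_of_moments[OF est(6,7,1) V0] by blast
  with est(1,2) var show ?thesis by blast
qed

end
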